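(* Let $G$ be a finite complex reflection group acting on $\mathbb C^d$, and let $\boldsymbol f:\Omega_1\to\Omega_2$ be a proper holomorphic map between domains in $\mathbb C^d$ with $G$ as the group of deck transformations. Then there exists a unique biholomorphic map $\widehat{\boldsymbol f}:\boldsymbol\theta(\Omega_1)\to\Omega_2$ such that $\boldsymbol f=\widehat{\boldsymbol f}\circ\boldsymbol\theta$, where $\boldsymbol\theta:\Omega_1\to\boldsymbol\theta(\Omega_1)$ is a basic polynomial map associated to $G$.
   Context: A complex reflection on $\mathbb C^d$ is a linear map $\sigma$ of finite order in $GL(d,\mathbb C)$ such that $\mathrm{id}-\sigma$ has rank $1$ (also called a pseudoreflection). A finite complex reflection group is a finite subgroup $G\subset GL(d,\mathbb C)$ generated by complex reflections. $G$ acts on $\mathbb C^d$ by $\sigma\cdot\boldsymbol z=\sigma^{-1}\boldsymbol z$. A basic polynomial map associated to $G$ is $\boldsymbol\theta=(\theta_1,\dots,\theta_d):\mathbb C^d\to\mathbb C^d$, where $\theta_1,\dots,\theta_d$ are algebraically independent homogeneous polynomials with $\mathbb C[z_1,\dots,z_d]^G=\mathbb C[\theta_1,\dots,\theta_d]$ (these exist by the Chevalley–Shephard–Todd theorem). For a $G$-invariant domain $\Omega_1$, $\boldsymbol\theta(\Omega_1)$ is a domain. A proper holomorphic map $\boldsymbol f:\Omega_1\to\Omega_2$ has $G$ as its group of deck transformations (equivalently, is factored by automorphisms $G$) if $\Omega_1$ is $G$-invariant and $\boldsymbol f^{-1}(\boldsymbol f(\boldsymbol z))=\{\sigma\cdot\boldsymbol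 z:\sigma\in G\}$ for all $\boldsymbol z\in\Omega_1$. *)

theory Defs
  imports
    "HOL-Analysis.Analysis"
    "HOL-Algebra.Generated_Groups"
    "HOL-Library.Poly_Mapping"
begin

definition GL :: "(complex^'n^'n) monoid" where
  "GL = \<lparr>carrier = {A. invertible A}, monoid.mult = (**), one = mat 1\<rparr>"

lemma group_GL: "group (GL :: (complex^'n^'n) monoid)"
proof (rule groupI)
  fix A :: "complex^'n^'n"
  assume "A \<in> carrier GL"
  then obtain B where "A ** B = mat 1" "B ** A = mat 1"
    by (auto simp: GL_def invertible_def)
  then show "\<exists>B\<in>carrier GL. B \<otimes>\<^bsub>GL\<^esub> A = \<one>\<^bsub>GL\<^esub>"
    by (auto simp: GL_def invertible_def)
next
  fix A B :: "complex^'n^'n"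
  assume "A \<in> carrier GL" "B \<in> carrier GL"
  then show "A \<otimes>\<^bsub>GL\<^esub> B \<in> carrier GL"
    by (simp add: GL_def invertible_mult)
next
  show "\<one>\<^bsub>GL\<^esub> \<in> carrier (GL :: (complex^'n^'n) monoid)"
    by (auto simp: GL_def invertible_def intro: exI[of _ "mat 1"])
qed (simp_all add: GL_def matrix_mul_assoc)

lemma inv_GL:
  fixes A :: "complex^'n^'n"
  assumes "A \<in> carrier GL"
  shows "inv\<^bsub>GL\<^esub> A = matrix_inv A"
proof -
  have "\<exists>B. A ** B = mat 1 \<and> B ** A = mat 1"
    using assms by (simp add: GL_def invertible_def)
  then have "A ** matrix_inv A = mat 1 \<and> matrix_inv A ** A = mat 1"
    unfolding matrix_inv_def by (rule someI_ex)
  with assms show ?thesis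
    by (intro group.inv_equality[OF group_GL]) (auto simp: GL_def invertible_def)
qed

definition complex_reflection :: "complex^'n^'n \<Rightarrow> bool" where
  "complex_reflection A \<longleftrightarrow>
     A \<in> carrier GL \<and> (\<exists>k::nat. k > 0 \<and> A [^]\<^bsub>GL\<^esub> k = \<one>\<^bsub>GL\<^esub>) \<and> rank (mat 1 - A) = 1"

definition complex_reflection_group :: "(complex^'n^'n) set \<Rightarrow> bool" where
  "complex_reflection_group G \<longleftrightarrow>
     finite G \<and> subgroup G GL \<and> (\<exists>S. (\<forall>A\<in>S. complex_reflection A) \<and> G = generate GL S)"

definition act :: "complex^'n^'n \<Rightarrow> complex^'n \<Rightarrow> complex^'n" where
  "act A z = matrix_inv A *v z"


text \<open>
  A polynomial in \<open>z\<^sub>i\<close>, \<open>i :: 'n\<close>, maps each exponent vector to its coefficient;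
  multiplication on this type is convolution.
\<close>

type_synonym 'n cpoly = "('n \<Rightarrow>\<^sub>0 nat) \<Rightarrow>\<^sub>0 complex"

text \<open>
  Substitution of ring elements \<open>x\<^sub>i\<close> for the variables, where \<open>c\<close> embeds the
  coefficients into the target ring.
\<close>

definition poly_subst :: "(complex \<Rightarrow> 'a::comm_ring_1) \<Rightarrow> ('n::finite \<Rightarrow> 'a) \<Rightarrow> 'n cpoly \<Rightarrow> 'a" where
  "poly_subst c x p =
     (\<Sum>m\<in>Poly_Mapping.keys p. c (Poly_Mapping.lookup p m) * (\<Prod>i\<in>UNIV. x i ^ Poly_Mapping.lookup m i))"

definition poly_eval :: "'n::finite cpoly \<Rightarrow> complex^'n \<Rightarrow> complex" where
  "poly_eval p z = poly_subst id (\<lambda>i. z $ i) p"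

definition poly_compose :: "'n::finite cpoly \<Rightarrow> ('n \<Rightarrow> 'n cpoly) \<Rightarrow> 'n cpoly" where
  "poly_compose p q = poly_subst (Poly_Mapping.single 0) q p"

definition homogeneous :: "'n::finite cpoly \<Rightarrow> bool" where
  "homogeneous p \<longleftrightarrow> (\<exists>k. \<forall>m\<in>Poly_Mapping.keys p. (\<Sum>i\<in>UNIV. Poly_Mapping.lookup m i) = k)"

definition algebraically_independent :: "('n::finite \<Rightarrow> 'n cpoly) \<Rightarrow> bool" where
  "algebraically_independent \<theta> \<longleftrightarrow> (\<forall>p. poly_compose p \<theta> = 0 \<longrightarrow> p = 0)"

definition invariant_polys :: "(complex^'n^'n) set \<Rightarrow> 'n cpoly set" where
  "invariant_polys G = {p. \<forall>A\<in>G. \<forall>z. poly_eval p (act A z) = poly_eval p z}"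

definition basic_polynomials :: "(complex^'n^'n) set \<Rightarrow> ('n \<Rightarrow> 'n cpoly) \<Rightarrow> bool" where
  "basic_polynomials G \<theta> \<longleftrightarrow>
     (\<forall>i. homogeneous (\<theta> i)) \<and> algebraically_independent \<theta> \<and>
     invariant_polys G = range (\<lambda>p. poly_compose p \<theta>)"

definition poly_map :: "('n::finite \<Rightarrow> 'n cpoly) \<Rightarrow> complex^'n \<Rightarrow> complex^'n" where
  "poly_map \<theta> z = (\<chi> i. poly_eval (\<theta> i) z)"


definition is_domain :: "(complex^'n) set \<Rightarrow> bool" where
  "is_domain \<Omega> \<longleftrightarrow> open \<Omega> \<and> connected \<Omega> \<and> \<Omega> \<noteq> {}"

text \<open>
  Complex differentiability at each point: the real Frechet derivative exists and is
  complex linear (\<open>*s\<close> is complex scalar multiplication).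
\<close>

definition holomorphic_map_on :: "(complex^'n \<Rightarrow> complex^'m) \<Rightarrow> (complex^'n) set \<Rightarrow> bool" where
  "holomorphic_map_on f \<Omega> \<longleftrightarrow>
     (\<forall>z\<in>\<Omega>. \<exists>f'. Vector_Spaces.linear (*s) (*s) f' \<and> (f has_derivative f') (at z))"

definition proper_holomorphic_map ::
    "(complex^'n \<Rightarrow> complex^'n) \<Rightarrow> (complex^'n) set \<Rightarrow> (complex^'n) set \<Rightarrow> bool" where
  "proper_holomorphic_map f \<Omega>1 \<Omega>2 \<longleftrightarrow>
     f \<in> \<Omega>1 \<rightarrow> \<Omega>2 \<and> holomorphic_map_on f \<Omega>1 \<and>
     proper_map (top_of_set \<Omega>1) (top_of_set \<Omega>2) f"

lemma holomorphic_map_on_imp_continuous_on: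
  "holomorphic_map_on f \<Omega> \<Longrightarrow> continuous_on \<Omega> f"
  unfolding holomorphic_map_on_def
  by (meson continuous_at_imp_continuous_on has_derivative_continuous)

text \<open>
  The library notion of a proper map agrees here with the usual one in complex analysis,
  that preimages of compact sets are compact.
\<close>

lemma proper_holomorphic_map_iff_compact:
  "proper_holomorphic_map f \<Omega>1 \<Omega>2 \<longleftrightarrow>
     f \<in> \<Omega>1 \<rightarrow> \<Omega>2 \<and> holomorphic_map_on f \<Omega>1 \<and>
     (\<forall>K. compact K \<and> K \<subseteq> \<Omega>2 \<longrightarrow> compact {z\<in>\<Omega>1. f z \<in> K})"
proof (cases "f \<in> \<Omega>1 \<rightarrow> \<Omega>2 \<and> holomorphic_map_on f \<Omega>1")
  case True
  have *: "proper_map (top_of_set \<Omega>1) (top_of_set \<Omega>2) f"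
    if "\<And>K. compact K \<Longrightarrow> K \<subseteq> \<Omega>2 \<Longrightarrow> compact {z\<in>\<Omega>1. f z \<in> K}"
  proof (rule compact_imp_proper_map)
    show "k_space (top_of_set \<Omega>2)"
      by (simp add: metrizable_imp_k_space metrizable_space_subtopology metrizable_space_euclidean)
    show "kc_space (top_of_set \<Omega>2)"
      by (simp add: Hausdorff_imp_kc_space Hausdorff_space_subtopology)
    show "f \<in> topspace (top_of_set \<Omega>1) \<rightarrow> topspace (top_of_set \<Omega>2)"
      using True by simp
    show "continuous_map (top_of_set \<Omega>1) (top_of_set \<Omega>2) f \<or> kc_space (top_of_set \<Omega>1)"
      by (simp add: Hausdorff_imp_kc_space Hausdorff_space_subtopology)
  qed (use that in \<open>auto simp: compactin_subtopology\<close>)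
  show ?thesis
    using True * by (auto simp: proper_holomorphic_map_def proper_map_alt compactin_subtopology)
qed (auto simp: proper_holomorphic_map_def)

definition biholomorphic_map ::
    "(complex^'n \<Rightarrow> complex^'n) \<Rightarrow> (complex^'n) set \<Rightarrow> (complex^'n) set \<Rightarrow> bool" where
  "biholomorphic_map f \<Omega>1 \<Omega>2 \<longleftrightarrow>
     open \<Omega>1 \<and> open \<Omega>2 \<and> bij_betw f \<Omega>1 \<Omega>2 \<and>
     holomorphic_map_on f \<Omega>1 \<and> holomorphic_map_on (the_inv_into \<Omega>1 f) \<Omega>2"

definition deck_group ::
    "(complex^'n^'n) set \<Rightarrow> (complex^'n \<Rightarrow> complex^'n) \<Rightarrow> (complex^'n) set \<Rightarrow> bool" where
  "deck_group G f \<Omega> \<longleftrightarrow>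
     (\<forall>A\<in>G. act A ` \<Omega> \<subseteq> \<Omega>) \<and>
     (\<forall>z\<in>\<Omega>. {w\<in>\<Omega>. f w = f z} = {act A z |A. A \<in> G})"

end

theory Submission
  imports Defs "HOL-Complex_Analysis.Complex_Analysis"
begin

text \<open>
  On \<open>\<Omega>1\<close> the maps \<open>f\<close> and \<open>\<theta>\<close> have the same fibres, the \<open>G\<close>-orbits. Hence \<open>f\<close> descends to
  a unique function \<open>fhat\<close> on \<open>\<theta> ` \<Omega>1\<close>, and \<open>fhat\<close> is injective. The substance of the
  theorem is that \<open>\<theta> ` \<Omega>1\<close> is open, that \<open>fhat\<close> and its inverse are holomorphic, and
  that \<open>fhat\<close> is onto.

  The invariant theory needed is elementary. A product over \<open>G\<close> of translates of a polynomial
  is invariant, so it is a polynomial in \<open>\<theta>\<close>. Products of this kind show that \<open>\<theta>\<close> separates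
  orbits, that \<open>\<theta>\<close> is proper (each coordinate is a root of a monic polynomial with
  coefficients in the ring generated by \<open>\<theta>\<close>), that the derivative of \<open>\<theta>\<close> is injective at each
  point with trivial stabilizer, and that some polynomial \<open>D\<close>, not identically zero, satisfies
  \<open>D (\<theta> z) \<noteq> 0\<close> only for such \<open>z\<close>. The range of \<open>\<theta>\<close> is therefore closed, and it is open
  at its points outside the zeros of \<open>D\<close>; as a complex line minus the zeros of \<open>D\<close> is connected,
  \<open>\<theta>\<close> is surjective. A closed surjection whose fibres are the orbits of a finite group acting by
  homeomorphisms is open.

  Consequently \<open>fhat\<close> is continuous, and it is holomorphic outside the zeros of \<open>D\<close>, where
  \<open>\<theta>\<close> has local holomorphic inverses. The zeros of \<open>D\<close> are removed by
  \<open>Rado_with_weight_several_variables\<close>, a variant of Rado's theorem: if \<open>h\<close> and \<open>j\<close>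
  are continuous, both are holomorphic where \<open>j\<close> does not vanish, and the zeros of \<open>j\<close> are
  nowhere dense, then \<open>h\<close> is holomorphic. It reduces to one variable by restriction to complex
  lines. Since \<open>j\<close> is only assumed to be holomorphic off its own zeros, the same theorem gives
  Osgood's theorem \<open>injective_holomorphic_imp_holomorphic_inverse\<close>: apply it to the
  components of the inverse map, with the Jacobian determinant, composed with the inverse map, as
  \<open>j\<close>. Osgood's theorem makes the inverse of \<open>fhat\<close> holomorphic and the image \<open>f ` \<Omega>1\<close> open; this image is closed in \<open>\<Omega>2\<close> because
  \<open>f\<close> is proper, so it is all of \<open>\<Omega>2\<close>.
\<close>

section \<open>A weighted Rado theorem in one variable\<close>

text \<open>
  On the unit circle \<open>z * cnj z = 1\<close>, so \<open>p * cnj q\<close> is a Laurent polynomial there, and the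
  real part of a negative power is the real part of a positive one.
\<close>

lemma Re_mult_cnj_eq_Re_poly_on_circle:
  fixes p q :: "complex poly"
  shows "\<exists>s. \<forall>z. cmod z = 1 \<longrightarrow> Re (poly p z * cnj (poly q z)) = Re (poly s z)"
proof (induction p arbitrary: q)
  case 0
  show ?case by (rule exI[of _ 0]) simp
next
  case (pCons a p)
  obtain b q' where q: "q = pCons b q'" by (cases q)
  from pCons obtain s where s: "\<And>z. cmod z = 1 \<Longrightarrow> Re (poly p z * cnj (poly q' z)) = Re (poly s z)"
    by blast
  have "Re (poly (pCons a p) z * cnj (poly q z)) =
        Re (poly (smult (cnj a) q + smult (cnj b) (pCons 0 p) + s) z)" if z: "cmod z = 1" for z
  proof -
    have zz: "z * cnj z = 1"
      using z complex_norm_square[of z] by simp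
    have "poly (pCons a p) z * cnj (poly q z) =
        a * cnj (poly q z) + cnj b * (z * poly p z) + (z * cnj z) * (poly p z * cnj (poly q' z))"
      by (simp add: q algebra_simps)
    also have "Re \<dots> = Re (a * cnj (poly q z)) + Re (cnj b * (z * poly p z)) + Re (poly s z)"
      using s[OF z] by (simp add: zz)
    also have "Re (a * cnj (poly q z)) = Re (cnj a * poly q z)"
      by simp
    finally show ?thesis by (simp add: algebra_simps)
  qed
  then show ?case by blast
qed

text \<open>
  Closure under products uses \<open>2 * Re a * Re b = Re (a * b) + Re (a * cnj b)\<close>.
\<close>

lemma real_polynomial_eq_Re_poly_on_circle:
  fixes g :: "complex \<Rightarrow> real"
  assumes "real_polynomial_function g"
  shows "\<exists>p. \<forall>z. cmod z = 1 \<longrightarrow> g z = Re (poly p z)"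
  using assms
proof (induction)
  case (linear f)
  interpret bounded_linear f by fact
  have "f z = Re (poly [:0, Complex (f 1) (- f \<i>):] z)" for z
  proof -
    have "f z = f (Re z *\<^sub>R 1 + Im z *\<^sub>R \<i>)"
      by (metis complex_eq scaleR_conv_of_real mult.commute mult.right_neutral)
    then show ?thesis by (simp add: add scaleR)
  qed
  then show ?case by blast
next
  case (const c)
  show ?case by (rule exI[of _ "[:of_real c:]"]) simp
next
  case (add f g)
  then obtain p q where "\<And>z. cmod z = 1 \<Longrightarrow> f z = Re (poly p z)" "\<And>z. cmod z = 1 \<Longrightarrow> g z = Re (poly q z)"
    by blast
  then show ?case by (intro exI[of _ "p + q"]) simp
next
  case (mult f g)
  then obtain p q where pq: "\<And>z. cmod z = 1 \<Longrightarrow> f z = Re (poly p z)" "\<And>z. cmod z = 1 \<Longrightarrow> g z = Re (poly q z)"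
    by blast
  obtain s where s: "\<And>z. cmod z = 1 \<Longrightarrow> Re (poly p z * cnj (poly q z)) = Re (poly s z)"
    using Re_mult_cnj_eq_Re_poly_on_circle by blast
  have "f z * g z = Re (poly (smult (1/2) (p * q + s)) z)" if z: "cmod z = 1" for z
  proof -
    have "Re (poly (smult (1/2) (p * q + s)) z) = (Re (poly p z * poly q z) + Re (poly s z)) / 2"
      by simp
    also have "\<dots> = Re (poly p z) * Re (poly q z)"
      by (simp add: s[OF z, symmetric])
    finally show ?thesis using pq[OF z] by simp
  qed
  then show ?case by blast
qed

lemma continuous_on_circle_approx_Re_poly:
  fixes u :: "complex \<Rightarrow> real"
  assumes "continuous_on (sphere 0 1) u" "0 < e"
  shows "\<exists>p. \<forall>z\<in>sphere 0 1. \<bar>u z - Re (poly p z)\<bar> < e"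
proof -
  obtain g where "real_polynomial_function g" "\<And>z. z \<in> sphere 0 1 \<Longrightarrow> \<bar>u z - g z\<bar> < e"
    using Stone_Weierstrass_real_polynomial_function[OF compact_sphere assms] by blast
  then show ?thesis
    using real_polynomial_eq_Re_poly_on_circle[of g] by fastforce
qed

text \<open>
  A maximum principle that ignores the zeros of \<open>j\<close>. The function \<open>exp (n * k) * j\<close> is
  holomorphic on the open set where \<open>j\<close> does not vanish, and on the frontier of that set it is
  either zero or at most \<open>exp (n * e) * M\<close> in modulus. Taking \<open>n\<close>-th roots, the factor \<open>j\<close>
  and the constant \<open>M\<close> disappear in the limit.
\<close>

lemma Re_le_on_nonzero_set:
  fixes k j :: "complex \<Rightarrow> complex"
  assumes contk: "continuous_on (cball 0 1) k" and contj: "continuous_on (cball 0 1) j"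
    and holk: "k holomorphic_on {z \<in> ball 0 1. j z \<noteq> 0}"
    and holj: "j holomorphic_on {z \<in> ball 0 1. j z \<noteq> 0}"
    and le: "\<And>z. cmod z = 1 \<Longrightarrow> Re (k z) \<le> e"
    and w: "w \<in> ball 0 1" "j w \<noteq> 0"
  shows "Re (k w) \<le> e"
proof -
  define U where "U = {z \<in> ball 0 1. j z \<noteq> 0}"
  have "U = ball 0 1 \<inter> j -` (- {0})" by (auto simp: U_def)
  moreover have "open (ball 0 1 \<inter> j -` (- {0}))"
    by (rule continuous_open_preimage) (use contj in \<open>auto intro: continuous_on_subset\<close>)
  ultimately have opU: "open U" by simp
  have clU: "closure U \<subseteq> cball 0 1"
    by (rule closure_minimal) (auto simp: U_def)
  have fr: "cmod z = 1 \<or> j z = 0" if "z \<in> frontier U" for z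
  proof -
    have "z \<in> cball 0 1" "z \<notin> U"
      using that clU opU by (auto simp: frontier_def interior_open)
    then show ?thesis by (auto simp: U_def)
  qed
  obtain M where M: "\<And>z. z \<in> cball 0 1 \<Longrightarrow> cmod (j z) \<le> M"
    using compact_imp_bounded[OF compact_continuous_image[OF contj compact_cball]]
    unfolding bounded_iff by blast
  have M0: "0 < M"
    using M[of w] w by (auto intro: less_le_trans[of _ "cmod (j w)"])
  have bound: "exp (n * Re (k w)) * cmod (j w) \<le> exp (n * e) * M" for n :: nat
  proof -
    have "cmod (exp (of_nat n * k w) * j w) \<le> exp (n * e) * M"
    proof (rule maximum_modulus_frontier[where S = U and f = "\<lambda>z. exp (of_nat n * k z) * j z"])
      show "(\<lambda>z. exp (of_nat n * k z) * j z) holomorphic_on interior U"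
        using holk holj opU by (auto simp: interior_open U_def intro!: holomorphic_intros)
      show "continuous_on (closure U) (\<lambda>z. exp (of_nat n * k z) * j z)"
        using contk contj clU by (auto intro!: continuous_intros elim: continuous_on_subset)
      show "bounded U" by (rule bounded_subset[of "cball 0 1"]) (auto simp: U_def)
      show "w \<in> U" using w by (simp add: U_def)
      fix z assume "z \<in> frontier U"
      then consider "cmod z = 1" | "j z = 0" using fr by blast
      then show "cmod (exp (of_nat n * k z) * j z) \<le> exp (n * e) * M"
      proof cases
        case 1
        have "exp (real n * Re (k z)) * cmod (j z) \<le> exp (real n * e) * M"
          using le[OF 1] M[of z] 1 by (intro mult_mono) (auto intro: mult_left_mono)
        then show ?thesis by (simp add: norm_mult)
      qed (use M0 in simp)
    qed
    then show ?thesis by (simp add: norm_mult)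
  qed
  show ?thesis
  proof (rule ccontr)
    assume "\<not> Re (k w) \<le> e"
    then obtain n :: nat where n: "n * (Re (k w) - e) > ln (M / cmod (j w))"
      using reals_Archimedean3[of "Re (k w) - e"] by auto
    have "exp (n * (Re (k w) - e)) = exp (n * Re (k w)) / exp (n * e)"
      by (simp add: right_diff_distrib exp_diff)
    also have "\<dots> \<le> M / cmod (j w)"
      using bound[of n] w by (simp add: field_simps)
    finally have "n * (Re (k w) - e) \<le> ln (M / cmod (j w))"
      using M0 w by (subst ln_ge_iff) auto
    with n show False by simp
  qed
qed

text \<open>
  A weak Borel-Caratheodory estimate: the function \<open>exp (p / e)\<close> has modulus between \<open>exp (-1)\<close>
  and \<open>exp 1\<close>, so that the Cauchy inequality for it bounds the derivative of \<open>p\<close>.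
\<close>

lemma norm_deriv_le_of_Re_bound:
  assumes hol: "p holomorphic_on UNIV" and e: "0 < e"
    and bound: "\<And>z. z \<in> cball 0 1 \<Longrightarrow> \<bar>Re (p z)\<bar> \<le> e"
    and w: "w \<in> ball 0 1"
  shows "cmod (deriv p w) \<le> e * exp 2 / (1 - cmod w)"
proof -
  define r where "r = 1 - cmod w"
  have r: "0 < r" using w by (simp add: r_def)
  define E where "E z = exp (p z / of_real e)" for z
  have holE: "E holomorphic_on S" for S
    unfolding E_def using hol e by (auto intro!: holomorphic_intros elim: holomorphic_on_subset)
  have nE: "cmod (E z) = exp (Re (p z) / e)" for z
    by (simp add: E_def)
  have "cmod ((deriv ^^ 1) E w) \<le> fact 1 * exp 1 / r ^ 1"
  proof (rule Cauchy_inequality)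
    fix x assume "cmod (w - x) = r"
    then have "cmod x \<le> 1"
      using norm_triangle_ineq2[of x w] by (simp add: r_def norm_minus_commute)
    then show "cmod (E x) \<le> exp 1"
      using bound[of x] e by (simp add: nE abs_le_iff)
  qed (use holE r in \<open>auto intro: holomorphic_on_imp_continuous_on\<close>)
  moreover have "deriv E w = deriv p w / of_real e * E w"
    unfolding E_def using hol e
    by (intro DERIV_imp_deriv) (auto intro!: derivative_eq_intros holomorphic_derivI[OF hol])
  moreover have "exp (-1) \<le> cmod (E w)"
    using bound[of w] w e by (auto simp: nE field_simps abs_le_iff)
  ultimately have "cmod (deriv p w) / e * cmod (E w) \<le> exp 1 / r" and "exp (-1) \<le> cmod (E w)"
    using e by (simp_all add: norm_mult norm_divide)
  then have "cmod (deriv p w) / e * exp (-1) \<le> exp 1 / r"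
    using e by (meson order_trans mult_left_mono divide_nonneg_pos norm_ge_zero)
  then have "cmod (deriv p w) \<le> e * (exp 1 * exp 1) / r"
    using e r by (simp add: field_simps exp_minus)
  then show ?thesis
    by (simp add: r_def flip: exp_add)
qed

lemma entire_norm_le_of_Re_bound:
  assumes hol: "p holomorphic_on UNIV" and e: "0 < e" and im: "Im (p 0) = 0"
    and bound: "\<And>z. z \<in> cball 0 1 \<Longrightarrow> \<bar>Re (p z)\<bar> \<le> e"
    and w: "cmod w \<le> r" and r: "r < 1"
  shows "cmod (p w) \<le> e * (1 + exp 2 / (1 - r))"
proof -
  have r0: "0 \<le> r" using w norm_ge_zero[of w] by linarith
  have "cmod (p w - p 0) \<le> e * exp 2 / (1 - r) * cmod (w - 0)"
  proof (rule field_differentiable_bound[where S = "cball 0 r" and f' = "deriv p"])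
    fix z :: complex assume z: "z \<in> cball 0 r"
    show "(p has_field_derivative deriv p z) (at z within cball 0 r)"
      by (rule has_field_derivative_at_within, rule holomorphic_derivI[OF hol]) auto
    have "cmod (deriv p z) \<le> e * exp 2 / (1 - cmod z)"
      by (rule norm_deriv_le_of_Re_bound[OF hol e bound]) (use z r in auto)
    also have "\<dots> \<le> e * exp 2 / (1 - r)"
      using z r e by (intro divide_left_mono) auto
    finally show "cmod (deriv p z) \<le> e * exp 2 / (1 - r)" .
  qed (use w r0 in auto)
  also have "\<dots> \<le> e * exp 2 / (1 - r) * 1"
    using w r e by (intro mult_left_mono) auto
  finally have "cmod (p w - p 0) \<le> e * (exp 2 / (1 - r))" by simp
  moreover have "cmod (p 0) \<le> e"
    using bound[of 0] im cmod_eq_Re by auto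
  ultimately show ?thesis
    using norm_triangle_ineq[of "p w - p 0" "p 0"] by (simp add: distrib_left)
qed

text \<open>
  The Dirichlet problem on the disc, with the solution as the real part of a holomorphic function:
  real parts of polynomials approximate \<open>u\<close> on the circle, hence by the maximum principle form a
  Cauchy sequence on the disc; normalized to be real at \<open>0\<close>, the polynomials themselves converge
  locally uniformly.
\<close>

lemma harmonic_extension_of_circle_function:
  fixes u :: "complex \<Rightarrow> real"
  assumes cont: "continuous_on (sphere 0 1) u"
  shows "\<exists>P. P holomorphic_on ball 0 1 \<and> (\<forall>e>0. \<exists>p. p holomorphic_on UNIV \<and> (\<forall>z\<in>sphere 0 1. \<bar>u z - Re (p z)\<bar> \<le> e) \<and>
       (\<forall>z\<in>ball 0 1. \<bar>Re (P z) - Re (p z)\<bar> \<le> e))"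
proof -
  define d where "d n = inverse (real (Suc n))" for n
  have d: "0 < d n" for n by (simp add: d_def)
  have d0: "d \<longlonglongrightarrow> 0"
    unfolding d_def by (rule LIMSEQ_inverse_real_of_nat)
  obtain p where p: "\<And>n z. z \<in> sphere 0 1 \<Longrightarrow> \<bar>u z - Re (poly (p n) z)\<bar> < d n"
    using continuous_on_circle_approx_Re_poly[OF cont d] by metis
  \<comment> \<open>The imaginary parts are controlled only after fixing their value at the centre.\<close>
  define q where "q n z = poly (p n) z - \<i> * Im (poly (p n) 0)" for n z
  have hol: "(\<lambda>z. q m z - q n z) holomorphic_on S" "q n holomorphic_on S" for m n S
    by (auto simp: q_def[abs_def] intro!: holomorphic_intros)
  have Re_q: "\<bar>u z - Re (q n z)\<bar> < d n" if "z \<in> sphere 0 1" for n z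
    using p[OF that, of n] by (simp add: q_def)
  have le1: "Re (q m z - q n z) \<le> d m + d n" if z: "z \<in> cball 0 1" for m n z
  proof (cases "z \<in> ball 0 1")
    case True
    show ?thesis
    proof (rule Re_le_on_nonzero_set[where j = "\<lambda>_. 1" and k = "\<lambda>z. q m z - q n z"])
      fix w :: complex assume "cmod w = 1"
      then have "w \<in> sphere 0 1" by simp
      then show "Re (q m w - q n w) \<le> d m + d n"
        using Re_q[of w m] Re_q[of w n] unfolding minus_complex.sel by linarith
    qed (use True hol in \<open>auto intro: holomorphic_on_imp_continuous_on\<close>)
  next
    case False
    then have "z \<in> sphere 0 1" using z by simp
    then show ?thesis
      using Re_q[of z m] Re_q[of z n] unfolding minus_complex.sel by linarith
  qed
  have le2: "\<bar>Re (q m z - q n z)\<bar> \<le> d m + d n" if "z \<in> cball 0 1" for m n z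
    using le1[OF that, of m n] le1[OF that, of n m] by simp
  have le3: "cmod (q m z - q n z) \<le> (d m + d n) * (1 + exp 2 / (1 - r))"
    if "cmod z \<le> r" "r < 1" for m n z r
  proof (rule entire_norm_le_of_Re_bound[where p = "\<lambda>z. q m z - q n z"])
    show "0 < d m + d n" using d[of m] d[of n] by simp
    show "Im (q m 0 - q n 0) = 0" by (simp add: q_def)
  qed (use hol le2 that in auto)
  have unif: "uniformly_convergent_on (cball 0 r) q" if r: "0 \<le> r" "r < 1" for r
  proof (rule Cauchy_uniformly_convergent, rule uniformly_Cauchy_onI)
    fix e :: real assume e: "0 < e"
    define C where "C = 1 + exp 2 / (1 - r)"
    have C: "0 < C" using r by (auto simp: C_def intro: add_pos_nonneg)
    have "eventually (\<lambda>n. d n < e / (2 * C)) sequentially"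
      using order_tendstoD(2)[OF d0, of "e / (2 * C)"] e C by simp
    then obtain M where M: "\<And>n. n \<ge> M \<Longrightarrow> d n < e / (2 * C)"
      by (auto simp: eventually_sequentially)
    show "\<exists>M. \<forall>x\<in>cball 0 r. \<forall>m\<ge>M. \<forall>n\<ge>M. dist (q m x) (q n x) < e"
    proof (intro exI ballI allI impI)
      fix x :: complex and m n assume x: "x \<in> cball 0 r" and mn: "M \<le> m" "M \<le> n"
      have "dist (q m x) (q n x) \<le> (d m + d n) * C"
        using le3[of x r m n] x r by (simp add: dist_norm C_def)
      also have "\<dots> < (e / (2 * C) + e / (2 * C)) * C"
        using M[OF mn(1)] M[OF mn(2)] C by (intro mult_strict_right_mono add_strict_mono)
      also have "\<dots> = e" using C by simp
      finally show "dist (q m x) (q n x) < e" .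
    qed
  qed
  define P where "P z = lim (\<lambda>n. q n z)" for z
  have lim: "uniform_limit (cball 0 r) q P sequentially" if "0 \<le> r" "r < 1" for r
    using unif[OF that] by (simp add: uniformly_convergent_uniform_limit_iff P_def[abs_def])
  have "P holomorphic_on ball 0 1"
  proof (rule holomorphic_uniform_sequence)
    fix x :: complex assume x: "x \<in> ball 0 1"
    define s where "s = (1 - cmod x) / 2"
    have s: "0 < s" "cmod x + s < 1" using x by (auto simp: s_def field_simps)
    have sub: "cball x s \<subseteq> cball 0 (cmod x + s)"
      by (simp add: cball_subset_cball_iff)
    have "uniform_limit (cball x s) q P sequentially"
      by (rule uniform_limit_on_subset[OF lim sub]) (use s in auto)
    moreover have "cball x s \<subseteq> ball 0 1"
        using sub s by auto
      ultimately show "\<exists>d>0. cball x d \<subseteq> ball 0 1 \<and> uniform_limit (cball x d) q P sequentially"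
        using s by blast
    qed (use hol in auto)
  moreover have "\<exists>p. p holomorphic_on UNIV \<and> (\<forall>z\<in>sphere 0 1. \<bar>u z - Re (p z)\<bar> \<le> e) \<and>
       (\<forall>z\<in>ball 0 1. \<bar>Re (P z) - Re (p z)\<bar> \<le> e)" if "0 < e" for e
  proof -
    from that have "eventually (\<lambda>n. d n < e) sequentially"
      using order_tendstoD(2)[OF d0] by blast
    then obtain n where n: "d n < e"
      by (auto simp: eventually_sequentially)
    have "\<bar>Re (P z) - Re (q n z)\<bar> \<le> e" if z: "z \<in> ball 0 1" for z
    proof -
      have "(\<lambda>m. q m z) \<longlonglongrightarrow> P z"
        by (rule tendsto_uniform_limitI[OF lim[of "cmod z"]]) (use z in auto)
      then have "(\<lambda>m. \<bar>Re (q m z - q n z)\<bar>) \<longlonglongrightarrow> \<bar>Re (P z - q n z)\<bar>"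
        by (intro tendsto_intros)
      moreover have "(\<lambda>m. d m + d n) \<longlonglongrightarrow> 0 + d n"
        by (intro tendsto_intros d0)
      ultimately have "\<bar>Re (P z - q n z)\<bar> \<le> 0 + d n"
        by (rule LIMSEQ_le) (use le2[of z] z in auto)
      with n show ?thesis by simp
    qed
    moreover have "\<bar>u z - Re (q n z)\<bar> \<le> e" if "z \<in> sphere 0 1" for z
      using Re_q[OF that, of n] n by simp
    ultimately show ?thesis
      using hol(2)[of n UNIV] by blast
  qed
  ultimately show ?thesis by blast
qed

text \<open>
  Used to compare two holomorphic functions with the same real part.
\<close>

lemma deriv_zero_if_Re_zero:
  assumes hol: "f holomorphic_on U" and "open U" and z: "z \<in> U"
    and Re0: "\<And>z. z \<in> U \<Longrightarrow> Re (f z) = 0"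
  shows "deriv f z = 0"
proof -
  have "(f has_derivative (*) (deriv f z)) (at z)"
    using holomorphic_derivI[OF hol \<open>open U\<close> z] by (simp add: has_field_derivative_def)
  then have "((\<lambda>z. Re (f z)) has_derivative (\<lambda>v. Re (deriv f z * v))) (at z)"
    by (rule has_derivative_Re)
  moreover have "((\<lambda>z. Re (f z)) has_derivative (\<lambda>v. 0)) (at z)"
    by (rule has_derivative_transform_within_open[OF has_derivative_const[of 0] \<open>open U\<close> z])
       (simp add: Re0)
  ultimately have "(\<lambda>v. Re (deriv f z * v)) = (\<lambda>v. 0)"
    by (rule has_derivative_unique)
  then have "Re (deriv f z * 1) = 0" "Re (deriv f z * \<i>) = 0"
    by metis+
  then show ?thesis by (simp add: complex_eq_iff)
qed

text \<open>
  Where \<open>j\<close> does not vanish, the weighted maximum principle forces \<open>Re h\<close> and \<open>Im h\<close> to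
  equal the harmonic extensions \<open>Re P\<close> and \<open>Re Q\<close> of their values on the circle. There the
  Cauchy-Riemann equations for \<open>h\<close> say that \<open>P - \<i> * Q\<close> has derivative zero; by the identity
  theorem it is constant on the whole disc. So \<open>h\<close> coincides with \<open>P\<close> up to one additive
  constant, the same for all components of the set where \<open>j \<noteq> 0\<close>.
\<close>

lemma agrees_with_holomorphic_on_nonzero_set:
  fixes h j :: "complex \<Rightarrow> complex"
  assumes conth: "continuous_on (cball 0 1) h" and contj: "continuous_on (cball 0 1) j"
    and holh: "h holomorphic_on {z \<in> ball 0 1. j z \<noteq> 0}"
    and holj: "j holomorphic_on {z \<in> ball 0 1. j z \<noteq> 0}"
    and ne: "{z \<in> ball 0 1. j z \<noteq> 0} \<noteq> {}"
  obtains H where "H holomorphic_on ball 0 1" "\<And>z. z \<in> ball 0 1 \<Longrightarrow> j z \<noteq> 0 \<Longrightarrow> h z = H z"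
proof -
  define U where "U = {z \<in> ball 0 1. j z \<noteq> 0}"
  have "U = ball 0 1 \<inter> j -` (- {0})" by (auto simp: U_def)
  moreover have "open (ball 0 1 \<inter> j -` (- {0}))"
    by (rule continuous_open_preimage) (use contj in \<open>auto intro: continuous_on_subset\<close>)
  ultimately have opU: "open U" by simp
  have real_part: "\<exists>P. P holomorphic_on ball 0 1 \<and> (\<forall>z\<in>U. Re (k z) = Re (P z))"
    if contk: "continuous_on (cball 0 1) k" and holk: "k holomorphic_on U" for k
  proof -
    have "continuous_on (sphere 0 1) (\<lambda>z. Re (k z))"
      using contk by (auto intro!: continuous_intros elim: continuous_on_subset)
    then obtain P where P: "P holomorphic_on ball 0 1"
      "\<And>e. 0 < e \<Longrightarrow> \<exists>p. p holomorphic_on UNIV \<and> (\<forall>z\<in>sphere 0 1. \<bar>Re (k z) - Re (p z)\<bar> \<le> e) \<and>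
       (\<forall>z\<in>ball 0 1. \<bar>Re (P z) - Re (p z)\<bar> \<le> e)"
      using harmonic_extension_of_circle_function by metis
    have "Re (k z) = Re (P z)" if z: "z \<in> U" for z
    proof (rule ccontr)
      assume "Re (k z) \<noteq> Re (P z)"
      then have e: "0 < \<bar>Re (k z) - Re (P z)\<bar> / 3" by simp
      define e where "e = \<bar>Re (k z) - Re (P z)\<bar> / 3"
      obtain p where p: "p holomorphic_on UNIV" "\<And>z. z \<in> sphere 0 1 \<Longrightarrow> \<bar>Re (k z) - Re (p z)\<bar> \<le> e"
        "\<And>z. z \<in> ball 0 1 \<Longrightarrow> \<bar>Re (P z) - Re (p z)\<bar> \<le> e"
        using P(2)[OF e] unfolding e_def by blast
      have contp: "continuous_on S p" for S
        using holomorphic_on_imp_continuous_on[OF p(1)] continuous_on_subset by blast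
      have holp: "p holomorphic_on S" for S
        using p(1) by (auto elim: holomorphic_on_subset)
      have "Re (k z - p z) \<le> e"
        by (rule Re_le_on_nonzero_set[OF _ contj _ holj])
           (use contk contp holp holk p(2) z in \<open>auto simp: U_def abs_le_iff intro!: continuous_intros holomorphic_intros\<close>)
      moreover have "Re (p z - k z) \<le> e"
        by (rule Re_le_on_nonzero_set[OF _ contj _ holj])
           (use contk contp holp holk p(2) z in \<open>auto simp: U_def abs_le_iff intro!: continuous_intros holomorphic_intros\<close>)
      moreover have "\<bar>Re (P z) - Re (p z)\<bar> \<le> e"
        using p(3) z by (auto simp: U_def)
      ultimately have "\<bar>Re (k z) - Re (P z)\<bar> \<le> 2 * e"
        by simp
      then show False using e by (simp add: e_def)
    qed
    with P(1) show ?thesis by blast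
  qed
  have holh: "h holomorphic_on U" using holh by (simp add: U_def)
  obtain P where P: "P holomorphic_on ball 0 1" "\<And>z. z \<in> U \<Longrightarrow> Re (h z) = Re (P z)"
    using real_part[OF conth holh] by blast
  \<comment> \<open>The imaginary part of \<open>h\<close> is the real part of \<open>- \<i> * h\<close>.\<close>
  obtain Q where Q: "Q holomorphic_on ball 0 1" "\<And>z. z \<in> U \<Longrightarrow> Im (h z) = Re (Q z)"
    using real_part[of "\<lambda>z. - \<i> * h z", OF continuous_on_mult[OF continuous_on_const conth]
        holomorphic_on_mult[OF holomorphic_on_const holh]] by auto
  have UB: "U \<subseteq> ball 0 1" by (auto simp: U_def)
  define W where "W z = P z - \<i> * Q z" for z
  have holW: "W holomorphic_on ball 0 1"
    unfolding W_def[abs_def] by (intro holomorphic_intros P Q)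
  have dW: "deriv W z = 0" if z: "z \<in> U" for z
  proof -
    have zB: "z \<in> ball 0 1" using z UB by blast
    note dP = holomorphic_derivI[OF P(1) open_ball zB]
    note dQ = holomorphic_derivI[OF Q(1) open_ball zB]
    note dh = holomorphic_derivI[OF holh opU z]
    have "deriv (\<lambda>z. h z - P z) z = 0"
      by (rule deriv_zero_if_Re_zero[OF _ opU z])
         (use P holh UB in \<open>auto intro!: holomorphic_intros elim: holomorphic_on_subset\<close>)
    moreover have "deriv (\<lambda>z. h z - P z) z = deriv h z - deriv P z"
      by (intro DERIV_imp_deriv DERIV_diff dh dP)
    moreover have "deriv (\<lambda>z. - \<i> * h z - Q z) z = 0"
      by (rule deriv_zero_if_Re_zero[OF _ opU z])
         (use Q holh UB in \<open>auto intro!: holomorphic_intros elim: holomorphic_on_subset\<close>)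
    moreover have "deriv (\<lambda>z. - \<i> * h z - Q z) z = - \<i> * deriv h z - deriv Q z"
      by (intro DERIV_imp_deriv DERIV_diff DERIV_cmult dh dQ)
    moreover have "deriv W z = deriv P z - \<i> * deriv Q z"
      unfolding W_def[abs_def] by (intro DERIV_imp_deriv DERIV_diff DERIV_cmult dP dQ)
    ultimately have "deriv P z = deriv h z" "deriv Q z = - \<i> * deriv h z"
      "deriv W z = deriv P z - \<i> * deriv Q z"
      by simp_all
    then show ?thesis by simp
  qed
  obtain z0 where z0: "z0 \<in> U" using ne by (auto simp: U_def)
  have dW0: "deriv W z = 0" if "z \<in> ball 0 1" for z
    by (rule analytic_continuation_open[of U "ball 0 1" "deriv W" "\<lambda>_. 0"])
       (use opU z0 UB dW that in \<open>auto intro!: holomorphic_deriv holW\<close>)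
  have "\<exists>c. \<forall>z\<in>ball 0 1. W z = c"
  proof (rule has_field_derivative_zero_constant)
    fix z :: complex assume "z \<in> ball 0 1"
    then show "(W has_field_derivative 0) (at z within ball 0 1)"
      using holomorphic_derivI[OF holW open_ball, of z] dW0[of z] has_field_derivative_at_within by fastforce
  qed simp
  then obtain c where c: "\<And>z. z \<in> ball 0 1 \<Longrightarrow> W z = c" by blast
  show thesis
  proof
    show "(\<lambda>z. P z - \<i> * Im c) holomorphic_on ball 0 1"
      by (intro holomorphic_intros P)
    fix z :: complex assume "z \<in> ball 0 1" "j z \<noteq> 0"
    then have z: "z \<in> U" "z \<in> ball 0 1" by (auto simp: U_def)
    have "Re (Q z) = Im (P z) - Im c"
      using c[OF z(2)] by (auto simp: W_def)
    then show "h z = P z - \<i> * Im c"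
      using P(2)[OF z(1)] Q(2)[OF z(1)] by (simp add: complex_eq_iff)
  qed
qed

lemma open_fsigma:
  fixes S :: "'a::euclidean_space set"
  assumes "open S"
  shows "fsigma S"
proof -
  obtain C :: "nat \<Rightarrow> 'a set" where "\<And>n. compact (C n)" "\<Union>(range C) = S"
    using open_Union_compact_subsets[OF assms] by metis
  then show ?thesis
    using fsigma.intros[of C] compact_imp_closed by metis
qed

text \<open>
  The case \<open>h = j\<close> is Rado's theorem. It is used first: the nonzero set \<open>U\<close> of \<open>j\<close> is open
  and closed in the disc minus the zeros of the holomorphic function \<open>J\<close> that agrees with \<open>j\<close>
  on \<open>U\<close>. These zeros are countable, so \<open>U\<close> has countable complement in the disc, and
  \<open>h\<close> agrees with its holomorphic counterpart everywhere by continuity.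
\<close>

theorem Rado_with_weight:
  fixes h j :: "complex \<Rightarrow> complex"
  assumes conth: "continuous_on (cball 0 1) h" and contj: "continuous_on (cball 0 1) j"
    and holh: "h holomorphic_on {z \<in> ball 0 1. j z \<noteq> 0}"
    and holj: "j holomorphic_on {z \<in> ball 0 1. j z \<noteq> 0}"
    and ne: "{z \<in> ball 0 1. j z \<noteq> 0} \<noteq> {}"
  shows "h holomorphic_on ball 0 1"
proof -
  define U where "U = {z \<in> ball 0 1. j z \<noteq> 0}"
  have "U = ball 0 1 \<inter> j -` (- {0})" by (auto simp: U_def)
  moreover have "open (ball 0 1 \<inter> j -` (- {0}))"
    by (rule continuous_open_preimage) (use contj in \<open>auto intro: continuous_on_subset\<close>)
  ultimately have opU: "open U" by simp
  obtain J where J: "J holomorphic_on ball 0 1" "\<And>z. z \<in> ball 0 1 \<Longrightarrow> j z \<noteq> 0 \<Longrightarrow> j z = J z"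
    using agrees_with_holomorphic_on_nonzero_set[OF contj contj holj holj ne] by blast
  obtain H where H: "H holomorphic_on ball 0 1" "\<And>z. z \<in> ball 0 1 \<Longrightarrow> j z \<noteq> 0 \<Longrightarrow> h z = H z"
    using agrees_with_holomorphic_on_nonzero_set[OF conth contj holh holj ne] by blast
  have open_ne: "open {z \<in> ball 0 1. f z \<noteq> g z}"
    if "continuous_on (cball 0 1) f" "g holomorphic_on ball 0 1" for f g :: "complex \<Rightarrow> complex"
  proof -
    have "{z \<in> ball 0 1. f z \<noteq> g z} = ball 0 1 \<inter> (\<lambda>z. f z - g z) -` (- {0})" by auto
    moreover have "open (ball 0 1 \<inter> (\<lambda>z. f z - g z) -` (- {0}))"
      by (rule continuous_open_preimage)
         (use that in \<open>auto intro!: continuous_on_diff intro: continuous_on_subset holomorphic_on_imp_continuous_on\<close>)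
    ultimately show ?thesis by simp
  qed
  define Z where "Z = {z \<in> ball 0 1. J z = 0}"
  obtain z0 where z0: "z0 \<in> U" using ne by (auto simp: U_def)
  have Uz: "j z \<noteq> 0" "J z \<noteq> 0" "z \<in> ball 0 1" if "z \<in> U" for z
    using that J(2)[of z] by (auto simp: U_def)
  have "countable Z"
  proof (cases "J constant_on ball 0 1")
    case True
    then have "Z = {}"
      using Uz[OF z0] by (fastforce simp: Z_def constant_on_def)
    then show ?thesis by simp
  next
    case False
    then show ?thesis
      unfolding Z_def by (intro holomorphic_countable_zeros J open_fsigma) auto
  qed
  then have conn: "connected (ball 0 1 - Z)"
    by (intro connected_open_diff_countable) auto
  have "ball 0 1 - Z \<subseteq> U"
  proof -
    have cover: "ball 0 1 - Z \<subseteq> U \<union> {z \<in> ball 0 1. j z \<noteq> J z}"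
      by (auto simp: U_def Z_def)
    have disj: "U \<inter> {z \<in> ball 0 1. j z \<noteq> J z} \<inter> (ball 0 1 - Z) = {}"
      using J(2) by (auto simp: U_def)
    have "z0 \<in> U \<inter> (ball 0 1 - Z)"
      using z0 Uz[OF z0] by (auto simp: Z_def)
    then have "{z \<in> ball 0 1. j z \<noteq> J z} \<inter> (ball 0 1 - Z) = {}"
      using connectedD[OF conn opU open_ne[OF contj J(1)] disj cover] by blast
    with cover show ?thesis by blast
  qed
  then have sub: "{z \<in> ball 0 1. h z \<noteq> H z} \<subseteq> Z"
    using H(2) Uz by blast
  have "h z = H z" if "z \<in> ball 0 1" for z
  proof (rule ccontr)
    assume "h z \<noteq> H z"
    then have "z \<in> {z \<in> ball 0 1. h z \<noteq> H z}" using that by blast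
    then obtain e where e: "0 < e" "ball z e \<subseteq> {z \<in> ball 0 1. h z \<noteq> H z}"
      using open_ne[OF conth H(1)] openE by metis
    have "countable (ball z e)"
      by (rule countable_subset[OF order_trans[OF e(2) sub] \<open>countable Z\<close>])
    with uncountable_ball[OF e(1), of z] show False by simp
  qed
  then show ?thesis
    using holomorphic_transform[OF H(1)] by metis
qed

section \<open>Complex differentiability in several variables\<close>

lemma norm_vector_scalar_mult: "norm (c *s v) = cmod c * norm (v :: complex^'n)"
  by (simp add: norm_vec_def norm_mult L2_set_right_distrib)

lemma scaleR_eq_vector_scalar_mult: "r *\<^sub>R (v :: complex^'n) = of_real r *s v"
  unfolding vec_eq_iff vector_scaleR_component vector_smult_component by (simp add: scaleR_conv_of_real)

text \<open>
  Scalar-valued functions are treated with their own notion of complex differentiability at a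
  point; a map into \<open>complex^'m\<close> is holomorphic iff its components are.
\<close>

definition complex_differentiable :: "(complex^'n \<Rightarrow> complex) \<Rightarrow> complex^'n \<Rightarrow> bool" where
  "complex_differentiable h z \<longleftrightarrow> (\<exists>h'. (h has_derivative h') (at z) \<and> (\<forall>c v. h' (c *s v) = c * h' v))"

definition complex_derivative :: "(complex^'n \<Rightarrow> complex) \<Rightarrow> complex^'n \<Rightarrow> complex^'n \<Rightarrow> complex" where
  "complex_derivative h z v = deriv (\<lambda>t. h (z + t *s v)) 0"

lemma bounded_linear_vector_scalar_mult_left: "bounded_linear (\<lambda>t. t *s (v :: complex^'n))"
  by (rule bounded_linear_intro[where K = "norm v"])
     (auto simp: vec_eq_iff algebra_simps norm_vector_scalar_mult)

lemma continuous_on_vector_scalar_mult [continuous_intros]: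
  "continuous_on S f \<Longrightarrow> continuous_on S (\<lambda>x. f x *s (v :: complex^'n))"
  by (rule bounded_linear.continuous_on[OF bounded_linear_vector_scalar_mult_left])

lemma has_field_derivative_along_line:
  fixes h :: "complex^'n \<Rightarrow> complex"
  assumes h: "(h has_derivative h') (at (z + t *s v))" and lin: "\<And>c v. h' (c *s v) = c * h' v"
  shows "((\<lambda>t. h (z + t *s v)) has_field_derivative h' v) (at t)"
proof -
  have "((\<lambda>t. z + t *s v) has_derivative (\<lambda>s. s *s v)) (at t)"
    using has_derivative_add[OF has_derivative_const
        bounded_linear_imp_has_derivative[OF bounded_linear_vector_scalar_mult_left]] by simp
  from has_derivative_compose[OF this h]
  show ?thesis
    by (simp add: has_field_derivative_def lin mult.commute[of _ "h' v"])
qed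

lemma complex_differentiable_along_line:
  assumes "complex_differentiable h (z + t *s v)"
  shows "(\<lambda>t. h (z + t *s v)) field_differentiable at t"
  using assms has_field_derivative_along_line unfolding complex_differentiable_def field_differentiable_def by blast

lemma complex_differentiable_has_derivative:
  assumes "complex_differentiable h z"
  shows "(h has_derivative complex_derivative h z) (at z)"
    and "complex_derivative h z (c *s v) = c * complex_derivative h z v"
proof -
  obtain h' where h': "(h has_derivative h') (at z)" "\<And>c v. h' (c *s v) = c * h' v"
    using assms by (auto simp: complex_differentiable_def)
  have "complex_derivative h z = h'"
  proof
    fix v
    have "((\<lambda>t. h (z + t *s v)) has_field_derivative h' v) (at 0)"
      by (rule has_field_derivative_along_line) (use h' in auto)
    then show "complex_derivative h z v = h' v"
      unfolding complex_derivative_def by (rule DERIV_imp_deriv)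
  qed
  with h' show "(h has_derivative complex_derivative h z) (at z)" "complex_derivative h z (c *s v) = c * complex_derivative h z v"
    by auto
qed

lemma has_derivative_imp_complex_derivative:
  assumes "(h has_derivative h') (at z)" "\<And>c v. h' (c *s v) = c * h' v"
  shows "complex_differentiable h z" "complex_derivative h z = h'"
proof -
  show "complex_differentiable h z" using assms by (auto simp: complex_differentiable_def)
  then show "complex_derivative h z = h'"
    using complex_differentiable_has_derivative(1) assms(1) has_derivative_unique by blast
qed

lemma complex_differentiable_imp_isCont: "complex_differentiable h z \<Longrightarrow> isCont h z"
  unfolding complex_differentiable_def using has_derivative_continuous by blast

lemma holomorphic_along_line:
  assumes "\<And>t. t \<in> S \<Longrightarrow> complex_differentiable h (z + t *s v)"
  shows "(\<lambda>t. h (z + t *s v)) holomorphic_on S"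
  unfolding holomorphic_on_def
  using assms complex_differentiable_along_line field_differentiable_at_within by blast

text \<open>
  The constant comes from the Cauchy inequality on discs of radius \<open>1/4\<close> about points of modulus
  at most \<open>1/2\<close>: the second derivative is at most \<open>2 * M / (1/4)^2\<close> in modulus.
\<close>

lemma Taylor_remainder_disc:
  assumes hol: "g holomorphic_on ball 0 1" and M: "\<And>t. t \<in> ball 0 1 \<Longrightarrow> cmod (g t) \<le> M"
    and s: "cmod s \<le> 1/2"
  shows "cmod (g s - g 0 - s * deriv g 0) \<le> 32 * M * (cmod s)\<^sup>2"
proof -
  have "cmod ((deriv ^^ 0) g s - (\<Sum>i\<le>1. (deriv ^^ i) g 0 * (s - 0) ^ i / fact i))
        \<le> (32 * M) * cmod (s - 0) ^ Suc 1 / fact 1"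
  proof (rule complex_Taylor[of "cball 0 (1/2)" 1 "\<lambda>i. (deriv ^^ i) g"])
    fix i and x :: complex assume x: "x \<in> cball 0 (1/2)"
    have hol_i: "(deriv ^^ i) g holomorphic_on ball 0 1"
      by (rule holomorphic_higher_deriv[OF hol]) simp
    have "x \<in> ball 0 1" using x by simp
    from has_field_derivative_at_within[OF holomorphic_derivI[OF hol_i open_ball this]]
    show "((deriv ^^ i) g has_field_derivative (deriv ^^ Suc i) g x) (at x within cball 0 (1/2))"
      by simp
  next
    fix x :: complex assume x: "x \<in> cball 0 (1/2)"
    have sub: "cball x (1/4) \<subseteq> ball 0 1"
    proof
      fix y assume "y \<in> cball x (1/4)"
      then show "y \<in> ball 0 1"
        using x norm_triangle_ineq2[of y x] by (simp add: dist_norm norm_minus_commute)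
    qed
    have "cmod ((deriv ^^ 2) g x) \<le> fact 2 * M / (1/4) ^ 2"
    proof (rule Cauchy_inequality)
      show "g holomorphic_on ball x (1/4)" "continuous_on (cball x (1/4)) g"
        using hol sub ball_subset_cball
        by (blast intro: holomorphic_on_subset holomorphic_on_imp_continuous_on)+
      fix y assume "cmod (x - y) = 1/4"
      then have "y \<in> cball x (1/4)" by (simp add: dist_norm)
      then have "y \<in> ball 0 1" using sub by blast
      then show "cmod (g y) \<le> M" by (rule M)
    qed simp
    then show "cmod ((deriv ^^ Suc 1) g x) \<le> 32 * M"
      by (simp add: numeral_2_eq_2 power2_eq_square)
  qed (use s in auto)
  then show ?thesis
    by (simp add: power2_eq_square algebra_simps)
qed

lemma eventually_small_step:
  fixes v :: "complex^'n"
  assumes "0 < r"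
  shows "\<forall>\<^sub>F n in sequentially. norm ((1 / of_nat (Suc n)) *s v) < r"
proof -
  have "(\<lambda>n. inverse (real (Suc n)) * norm v) \<longlonglongrightarrow> 0 * norm v"
    by (intro tendsto_intros LIMSEQ_inverse_real_of_nat)
  then have "\<forall>\<^sub>F n in sequentially. inverse (real (Suc n)) * norm v < r"
    using assms by (auto dest: order_tendstoD(2))
  then show ?thesis
    by (simp add: norm_vector_scalar_mult norm_inverse norm_of_nat norm_divide divide_inverse del: of_nat_Suc)
qed

text \<open>
  Osgood's lemma: a continuous function that is holomorphic on complex lines is complex
  differentiable. Uniform Taylor estimates along lines show that the directional derivatives are
  continuous and additive in the direction, and then that they form a Frechet derivative.
\<close>

locale holomorphic_on_lines =
  fixes h :: "complex^'n \<Rightarrow> complex" and V :: "(complex^'n) set"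
  assumes open_V: "open V" and cont: "continuous_on V h"
    and lines: "\<And>z v. (\<And>t. t \<in> cball 0 1 \<Longrightarrow> z + t *s v \<in> V) \<Longrightarrow> (\<lambda>t. h (z + t *s v)) holomorphic_on ball 0 1"
begin

text \<open>
  The hypothesis speaks about lines parametrized by the unit disc, so the direction is rescaled.
\<close>

lemma line_differentiable_0:
  assumes "z \<in> V"
  shows "(\<lambda>t. h (z + t *s v)) field_differentiable at 0"
proof -
  obtain r where r: "0 < r" "cball z r \<subseteq> V"
    using open_V assms open_contains_cball by blast
  \<comment> \<open>Adding \<open>1\<close> allows \<open>v = 0\<close>.\<close>
  define \<rho> where "\<rho> = r / (norm v + 1)"
  have "0 < norm v + 1" by (simp add: add_nonneg_pos)
  then have "0 < \<rho>" "\<rho> * norm v \<le> r"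
    using r(1) by (auto simp: \<rho>_def divide_le_eq distrib_left)
  have "z + t *s (of_real \<rho> *s v) \<in> V" if "t \<in> cball 0 1" for t
  proof -
    have "cmod t * (\<rho> * norm v) \<le> 1 * (\<rho> * norm v)"
      by (rule mult_right_mono) (use that \<open>0 < \<rho>\<close> in auto)
    also have "\<dots> \<le> r" using \<open>\<rho> * norm v \<le> r\<close> by simp
    finally have "norm (t *s (of_real \<rho> *s v)) \<le> r"
      using \<open>0 < \<rho>\<close> by (simp add: norm_vector_scalar_mult norm_mult mult.assoc)
    then have "z + t *s (of_real \<rho> *s v) \<in> cball z r"
      by (simp add: dist_norm)
    with r show ?thesis by blast
  qed
  from lines[OF this] have *: "(\<lambda>t. h (z + t *s (of_real \<rho> *s v))) field_differentiable at 0"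
    by (auto intro: holomorphic_on_imp_differentiable_at)
  have "(\<lambda>t. t / of_real \<rho>) field_differentiable at 0"
    using \<open>0 < \<rho>\<close> by (auto intro!: derivative_intros)
  then have "((\<lambda>t. h (z + t *s (of_real \<rho> *s v))) \<circ> (\<lambda>t. t / of_real \<rho>)) field_differentiable at 0"
    by (rule field_differentiable_compose) (use * in simp)
  then show ?thesis
    using \<open>0 < \<rho>\<close> by (simp add: o_def)
qed

lemma complex_derivative_scale:
  assumes "z \<in> V"
  shows "complex_derivative h z (c *s v) = c * complex_derivative h z v"
proof -
  have "((\<lambda>t. h (z + t *s v)) has_field_derivative complex_derivative h z v) (at (c * 0))"
    using line_differentiable_0[OF assms, of v] unfolding complex_derivative_def
    by (simp add: field_differentiable_derivI)
  moreover have "((\<lambda>t. c * t) has_field_derivative c) (at 0)"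
    by (auto intro!: derivative_eq_intros)
  ultimately have "((\<lambda>t. h (z + (c * t) *s v)) has_field_derivative complex_derivative h z v * c) (at 0)"
    by (rule DERIV_chain2)
  then have "((\<lambda>t. h (z + t *s (c *s v))) has_field_derivative c * complex_derivative h z v) (at 0)"
    by (simp add: mult.commute)
  then show ?thesis
    unfolding complex_derivative_def[of h z "c *s v"] by (rule DERIV_imp_deriv)
qed

text \<open>
  The one-variable estimate, on the line whose direction is \<open>v\<close> rescaled to length \<open>r\<close>.
\<close>

lemma Taylor_remainder:
  assumes sub: "cball a (2 * r) \<subseteq> V" and r: "0 < r"
    and M: "\<And>z. z \<in> cball a (2 * r) \<Longrightarrow> cmod (h z) \<le> M"
    and z: "z \<in> cball a r" and v: "norm v \<le> r / 2"
  shows "cmod (h (z + v) - h z - complex_derivative h z v) \<le> 32 * M * (norm v / r)\<^sup>2"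
proof (cases "v = 0")
  case True
  then show ?thesis by (simp add: complex_derivative_def)
next
  case False
  define s where "s = complex_of_real (norm v / r)"
  define u where "u = complex_of_real (r / norm v) *s v"
  have su: "s *s u = v"
    using False r by (simp add: s_def u_def)
  have norm_u: "norm u = r"
    using False r by (simp add: u_def norm_vector_scalar_mult norm_divide)
  have s: "cmod s = norm v / r" using r by (simp add: s_def norm_divide)
  have zV: "z \<in> V" using sub z r by auto
  have inV: "z + t *s u \<in> cball a (2 * r)" if "t \<in> cball 0 1" for t
  proof -
    have "norm (t *s u) \<le> r"
      using that r mult_right_mono[of "cmod t" 1 r] by (simp add: norm_vector_scalar_mult norm_u)
    then have "dist a (z + t *s u) \<le> dist a z + r"
      using norm_triangle_ineq4[of "a - z" "t *s u"] by (simp add: dist_norm algebra_simps)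
    then show ?thesis using z by simp
  qed
  define g where "g t = h (z + t *s u)" for t
  have "cmod (g s - g 0 - s * deriv g 0) \<le> 32 * M * (cmod s)\<^sup>2"
  proof (rule Taylor_remainder_disc)
    show "g holomorphic_on ball 0 1"
      unfolding g_def[abs_def] by (rule lines) (use inV sub in blast)
    show "cmod (g t) \<le> M" if "t \<in> ball 0 1" for t
      unfolding g_def by (rule M, rule inV) (use that in auto)
    show "cmod s \<le> 1/2" using v r by (simp add: s field_simps)
  qed
  moreover have "s * deriv g 0 = complex_derivative h z v"
    using complex_derivative_scale[OF zV, of s u] by (simp add: su) (simp add: complex_derivative_def g_def[abs_def])
  ultimately show ?thesis by (simp add: g_def su s)
qed

lemma local_bound:
  assumes "a \<in> V"
  obtains r M where "0 < r" "cball a (2 * r) \<subseteq> V" "0 \<le> M" "\<And>z. z \<in> cball a (2 * r) \<Longrightarrow> cmod (h z) \<le> M"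
proof -
  obtain R where R: "0 < R" "cball a R \<subseteq> V"
    using open_V assms open_contains_cball by blast
  have "bounded (h ` cball a R)"
    by (intro compact_imp_bounded compact_continuous_image compact_cball continuous_on_subset[OF cont R(2)])
  then obtain M where M: "\<And>z. z \<in> cball a R \<Longrightarrow> cmod (h z) \<le> M"
    unfolding bounded_iff by blast
  have "0 \<le> M" using order_trans[OF norm_ge_zero M[of a]] R(1) by simp
  then show thesis
    using that[of "R / 2" M] R M by auto
qed

lemma uniform_limit_difference_quotient:
  assumes sub: "cball a (2 * r) \<subseteq> V" and r: "0 < r" and "0 \<le> M"
    and M: "\<And>z. z \<in> cball a (2 * r) \<Longrightarrow> cmod (h z) \<le> M"
  shows "uniform_limit (cball a r) (\<lambda>n z. of_nat (Suc n) * (h (z + (1 / of_nat (Suc n)) *s v) - h z))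
           (\<lambda>z. complex_derivative h z v) sequentially"
proof (rule uniform_limitI)
  fix e :: real assume e: "0 < e"
  define K where "K = 32 * M * (norm v / r)\<^sup>2"
  have K: "0 \<le> K" using \<open>0 \<le> M\<close> by (simp add: K_def)
  obtain N :: nat where N: "2 * norm v / r < N" "K / e < N"
    using reals_Archimedean2[of "max (2 * norm v / r) (K / e)"] by auto
  have "dist (of_nat (Suc n) * (h (z + (1 / of_nat (Suc n)) *s v) - h z)) (complex_derivative h z v) < e"
    if n: "N \<le> n" and z: "z \<in> cball a r" for n z
  proof -
    define t where "t = (1 / of_nat (Suc n) :: complex)"
    have t: "cmod t = 1 / Suc n" "t \<noteq> 0"
      unfolding t_def by (auto simp: norm_divide simp del: of_nat_Suc)
    have zV: "z \<in> V" using sub z r by auto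
    have "2 * norm v / r < Suc n" using N(1) n by linarith
    then have "norm (t *s v) \<le> r / 2"
      using r by (simp add: norm_vector_scalar_mult t field_simps del: of_nat_Suc)
    from Taylor_remainder[OF sub r M z this]
    have "cmod (h (z + t *s v) - h z - t * complex_derivative h z v) \<le> K * (1 / Suc n)\<^sup>2"
      by (simp add: complex_derivative_scale[OF zV] norm_vector_scalar_mult t K_def power_mult_distrib power_divide ac_simps del: of_nat_Suc)
    then have "cmod (h (z + t *s v) - h z - t * complex_derivative h z v) / cmod t \<le> K * (1 / Suc n)\<^sup>2 / cmod t"
      by (rule divide_right_mono) simp
    also have "\<dots> = K / Suc n"
      by (simp add: t power2_eq_square field_simps del: of_nat_Suc)
    also have "\<dots> < e"
    proof -
      have "K / e < Suc n" using N(2) n by linarith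
      then show ?thesis using e by (simp add: field_simps del: of_nat_Suc)
    qed
    also have "cmod (h (z + t *s v) - h z - t * complex_derivative h z v) / cmod t =
        dist ((h (z + t *s v) - h z) / t) (complex_derivative h z v)"
      using t(2) by (simp add: dist_norm diff_divide_distrib flip: norm_divide)
    finally show ?thesis
      by (simp add: t_def mult.commute del: of_nat_Suc)
  qed
  then show "\<forall>\<^sub>F n in sequentially. \<forall>z\<in>cball a r.
      dist (of_nat (Suc n) * (h (z + (1 / of_nat (Suc n)) *s v) - h z)) (complex_derivative h z v) < e"
    unfolding eventually_sequentially by blast
qed

text \<open>
  Directional derivatives are locally uniform limits of difference quotients.
\<close>

lemma continuous_on_complex_derivative: "continuous_on V (\<lambda>z. complex_derivative h z v)"
proof -
  have "isCont (\<lambda>z. complex_derivative h z v) a" if aV: "a \<in> V" for a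
  proof -
    obtain r M where r: "0 < r" "cball a (2 * r) \<subseteq> V" "0 \<le> M" "\<And>z. z \<in> cball a (2 * r) \<Longrightarrow> cmod (h z) \<le> M"
      using local_bound[OF aV] by blast
    have "continuous_on (cball a r) (\<lambda>z. complex_derivative h z v)"
    proof (rule uniform_limit_theorem[OF _ uniform_limit_difference_quotient[OF r(2,1,3,4)]])
      show "\<forall>\<^sub>F n in sequentially. continuous_on (cball a r)
          (\<lambda>z. of_nat (Suc n) * (h (z + (1 / of_nat (Suc n)) *s v) - h z))"
        using eventually_small_step[OF r(1), of v]
      proof eventually_elim
        case (elim n)
        define w where "w = (1 / of_nat (Suc n)) *s v"
        have w: "norm w < r" using elim by (simp add: w_def)
        have "(\<lambda>z. z + w) ` cball a r \<subseteq> cball a (2 * r)"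
        proof clarsimp
          fix x assume "dist a x \<le> r"
          then show "dist a (x + w) \<le> 2 * r"
            using w norm_triangle_ineq4[of "a - x" w] by (simp add: dist_norm algebra_simps)
        qed
        then have "continuous_on (cball a r) (\<lambda>z. h (z + w))"
          by (intro continuous_on_compose2[OF continuous_on_subset[OF cont r(2)]] continuous_intros) auto
        moreover have "continuous_on (cball a r) h"
          by (rule continuous_on_subset[OF cont]) (use r in auto)
        ultimately show ?case
          unfolding w_def[symmetric] by (intro continuous_intros)
      qed
    qed auto
    then show ?thesis
      using r(1) by (metis centre_in_ball continuous_on_interior interior_cball)
  qed
  then show ?thesis by (simp add: continuous_at_imp_continuous_on)
qed

text \<open>
  The difference quotient in direction \<open>u + v\<close> at \<open>a\<close> is the sum of the one in direction
  \<open>u\<close> at \<open>a\<close> and the one in direction \<open>v\<close> at a point that tends to \<open>a\<close>; the latter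
  converges to the derivative at \<open>a\<close> by uniformity and continuity.
\<close>

lemma complex_derivative_add:
  assumes a: "a \<in> V"
  shows "complex_derivative h a (u + v) = complex_derivative h a u + complex_derivative h a v"
proof -
  obtain r M where r: "0 < r" "cball a (2 * r) \<subseteq> V" "0 \<le> M" "\<And>z. z \<in> cball a (2 * r) \<Longrightarrow> cmod (h z) \<le> M"
    using local_bound[OF a] by blast
  define t where "t n = (1 / of_nat (Suc n) :: complex)" for n
  define q where "q v n z = of_nat (Suc n) * (h (z + t n *s v) - h z)" for v n z
  have lim: "uniform_limit (cball a r) (q v) (\<lambda>z. complex_derivative h z v) sequentially" for v
    using uniform_limit_difference_quotient[OF r(2,1,3,4), of v] unfolding q_def t_def .
  have t0: "t \<longlonglongrightarrow> 0"
    unfolding t_def using LIMSEQ_inverse_real_of_nat[THEN tendsto_of_real[where 'a = complex]]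
    by (simp add: inverse_eq_divide del: of_nat_Suc)
  have in_ball: "\<forall>\<^sub>F n in sequentially. a + t n *s u \<in> cball a r"
    using eventually_small_step[OF r(1), of u] unfolding t_def
    by eventually_elim (simp add: dist_norm)
  have tu: "(\<lambda>n. a + t n *s u) \<longlonglongrightarrow> a + 0 *s u"
    by (intro tendsto_add tendsto_const bounded_linear.tendsto[OF bounded_linear_vector_scalar_mult_left] t0)
  have "(\<lambda>n. complex_derivative h (a + t n *s u) v) \<longlonglongrightarrow> complex_derivative h a v"
    using isCont_tendsto_compose[of a "\<lambda>z. complex_derivative h z v", OF _ tu[simplified]]
      continuous_on_complex_derivative open_V a continuous_on_eq_continuous_at by (auto simp: tu)
  moreover have "(\<lambda>n. q v n (a + t n *s u) - complex_derivative h (a + t n *s u) v) \<longlonglongrightarrow> 0"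
  proof (rule tendstoI)
    fix e :: real assume "0 < e"
    from uniform_limitD[OF lim[of v] this] in_ball
    show "\<forall>\<^sub>F n in sequentially. dist (q v n (a + t n *s u) - complex_derivative h (a + t n *s u) v) 0 < e"
      by eventually_elim (auto simp: dist_norm)
  qed
  ultimately have "(\<lambda>n. (q v n (a + t n *s u) - complex_derivative h (a + t n *s u) v) + complex_derivative h (a + t n *s u) v)
      \<longlonglongrightarrow> 0 + complex_derivative h a v"
    by (intro tendsto_add)
  moreover have qlim: "(\<lambda>n. q w n a) \<longlonglongrightarrow> complex_derivative h a w" for w
    by (rule tendsto_uniform_limitI[OF lim]) (use r in auto)
  ultimately have "(\<lambda>n. q v n (a + t n *s u) + q u n a) \<longlonglongrightarrow> complex_derivative h a v + complex_derivative h a u"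
    by (auto intro: tendsto_add)
  moreover have "(\<lambda>n. q v n (a + t n *s u) + q u n a) = (\<lambda>n. q (u + v) n a)"
  proof
    fix n
    have eq: "a + t n *s u + t n *s v = a + t n *s (u + v)"
      by (simp add: vec_eq_iff algebra_simps)
    show "q v n (a + t n *s u) + q u n a = q (u + v) n a"
      unfolding q_def eq by (simp add: algebra_simps)
  qed
  ultimately show ?thesis
    using qlim[of "u + v"] LIMSEQ_unique by (simp add: add.commute)
qed

theorem complex_differentiable_if_holomorphic_on_lines:
  assumes a: "a \<in> V"
  shows "complex_differentiable h a"
proof -
  obtain r M where r: "0 < r" "cball a (2 * r) \<subseteq> V" "0 \<le> M" "\<And>z. z \<in> cball a (2 * r) \<Longrightarrow> cmod (h z) \<le> M"
    using local_bound[OF a] by blast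
  have "linear (complex_derivative h a)"
    by (rule linearI) (simp_all add: complex_derivative_add[OF a] complex_derivative_scale[OF a] scaleR_eq_vector_scalar_mult scaleR_conv_of_real)
  then have bl: "bounded_linear (complex_derivative h a)"
    by (simp add: linear_conv_bounded_linear)
  have "(h has_derivative complex_derivative h a) (at a)"
  proof (rule has_derivativeI_sandwich[where e = "r / 2" and H = "\<lambda>y. 32 * M / r\<^sup>2 * norm (y - a)"])
    show "0 < r / 2" using r by simp
    show "bounded_linear (complex_derivative h a)" by (rule bl)
    show "((\<lambda>y. 32 * M / r\<^sup>2 * norm (y - a)) \<longlongrightarrow> 0) (at a)"
      by (rule tendsto_eq_intros refl | simp)+
    fix y assume y: "y \<noteq> a" "dist y a < r / 2"
    have "cmod (h (a + (y - a)) - h a - complex_derivative h a (y - a)) \<le> 32 * M * (norm (y - a) / r)\<^sup>2"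
      by (rule Taylor_remainder[OF r(2,1,4)]) (use y r in \<open>auto simp: dist_norm\<close>)
    then show "norm (h y - h a - complex_derivative h a (y - a)) / norm (y - a) \<le> 32 * M / r\<^sup>2 * norm (y - a)"
      using y r by (simp add: divide_simps power2_eq_square)
  qed
  then show ?thesis
    using has_derivative_imp_complex_derivative(1) complex_derivative_scale[OF a] by blast
qed

end

lemma complex_differentiable_transform:
  assumes "complex_differentiable h z" "open S" "z \<in> S" "\<And>x. x \<in> S \<Longrightarrow> h x = k x"
  shows "complex_differentiable k z"
  using assms has_derivative_transform_within_open unfolding complex_differentiable_def by blast

lemma complex_differentiable_const [intro]: "complex_differentiable (\<lambda>z. c) z"
  unfolding complex_differentiable_def by (rule exI[of _ "\<lambda>v. 0"]) simp

lemma complex_differentiable_add [intro]: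
  assumes "complex_differentiable h z" "complex_differentiable k z"
  shows "complex_differentiable (\<lambda>z. h z + k z) z"
  by (rule has_derivative_imp_complex_derivative(1)[OF has_derivative_add[OF complex_differentiable_has_derivative(1)[OF assms(1)]
        complex_differentiable_has_derivative(1)[OF assms(2)]]])
     (simp add: assms complex_differentiable_has_derivative(2) distrib_left)

lemma complex_differentiable_mult [intro]:
  assumes "complex_differentiable h z" "complex_differentiable k z"
  shows "complex_differentiable (\<lambda>z. h z * k z) z"
  by (rule has_derivative_imp_complex_derivative(1)[OF has_derivative_mult[OF complex_differentiable_has_derivative(1)[OF assms(1)]
        complex_differentiable_has_derivative(1)[OF assms(2)]]])
     (simp add: assms complex_differentiable_has_derivative(2) algebra_simps)

lemma complex_differentiable_diff [intro]:
  assumes "complex_differentiable h z" "complex_differentiable k z"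
  shows "complex_differentiable (\<lambda>z. h z - k z) z"
  using complex_differentiable_add[OF assms(1) complex_differentiable_mult[OF complex_differentiable_const[of "-1"] assms(2)]] by simp

lemma complex_differentiable_sum [intro]: "(\<And>i. i \<in> I \<Longrightarrow> complex_differentiable (h i) z) \<Longrightarrow> complex_differentiable (\<lambda>z. \<Sum>i\<in>I. h i z) z"
  by (induction I rule: infinite_finite_induct) auto

lemma complex_differentiable_prod [intro]: "(\<And>i. i \<in> I \<Longrightarrow> complex_differentiable (h i) z) \<Longrightarrow> complex_differentiable (\<lambda>z. \<Prod>i\<in>I. h i z) z"
  by (induction I rule: infinite_finite_induct) auto

lemma complex_differentiable_component [intro]: "complex_differentiable (\<lambda>z. z $ i) z"
  unfolding complex_differentiable_def
  by (rule exI[of _ "\<lambda>v. v $ i"])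
     (simp add: bounded_linear_imp_has_derivative bounded_linear_vec_nth)

lemma complex_differentiable_power [intro]: "complex_differentiable h z \<Longrightarrow> complex_differentiable (\<lambda>z. h z ^ n) z"
  by (induction n) auto

lemma bounded_linear_axis: "bounded_linear (\<lambda>c::complex. axis i c :: complex^'n)"
proof (rule bounded_linear_intro[where K = 1])
  fix c :: complex
  have "norm (axis i c :: complex^'n) \<le> (\<Sum>k\<in>UNIV. cmod ((axis i c :: complex^'n) $ k))"
    unfolding norm_vec_def by (rule L2_set_le_sum) simp
  also have "\<dots> = (\<Sum>k\<in>UNIV. if k = i then cmod c else 0)"
    by (rule sum.cong) (auto simp: axis_def)
  finally show "norm (axis i c :: complex^'n) \<le> norm c * 1"
    by simp
qed (simp_all add: vec_eq_iff axis_def)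

lemma vec_eq_sum_axis: "(v :: complex^'n) = (\<Sum>i\<in>UNIV. axis i (v $ i))"
  by (simp add: vec_eq_iff axis_def sum.delta')

lemma vector_linear_iff:
  fixes L :: "complex^'n \<Rightarrow> complex^'m"
  shows "Vector_Spaces.linear (*s) (*s) L \<longleftrightarrow>
    (\<forall>u v. L (u + v) = L u + L v) \<and> (\<forall>c v. L (c *s v) = c *s L v)"
  by (simp add: Vector_Spaces.linear_iff vec.vector_space_axioms)

definition complex_derivative_map :: "(complex^'n \<Rightarrow> complex^'m) \<Rightarrow> complex^'n \<Rightarrow> complex^'n \<Rightarrow> complex^'m" where
  "complex_derivative_map f z v = (\<chi> i. complex_derivative (\<lambda>x. f x $ i) z v)"

lemma has_derivative_complex_derivative_map:
  fixes f :: "complex^'n \<Rightarrow> complex^'m"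
  assumes "\<And>i. complex_differentiable (\<lambda>x. f x $ i) z"
  shows "(f has_derivative complex_derivative_map f z) (at z)" "Vector_Spaces.linear (*s) (*s) (complex_derivative_map f z)"
proof -
  have "((\<lambda>x. \<Sum>i\<in>UNIV. axis i (f x $ i)) has_derivative (\<lambda>v. \<Sum>i\<in>UNIV. axis i (complex_derivative (\<lambda>x. f x $ i) z v))) (at z)"
    by (intro has_derivative_sum bounded_linear.has_derivative[OF bounded_linear_axis] complex_differentiable_has_derivative assms)
  moreover have "(\<lambda>v. \<Sum>i\<in>UNIV. axis i (complex_derivative (\<lambda>x. f x $ i) z v)) = complex_derivative_map f z"
    using vec_eq_sum_axis[of "complex_derivative_map f z v" for v] by (auto simp: complex_derivative_map_def)
  ultimately show D: "(f has_derivative complex_derivative_map f z) (at z)"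
    by (simp flip: vec_eq_sum_axis)
  show "Vector_Spaces.linear (*s) (*s) (complex_derivative_map f z)"
    unfolding vector_linear_iff
  proof (intro conjI allI)
    show "complex_derivative_map f z (c *s v) = c *s complex_derivative_map f z v" for c v
      using complex_differentiable_has_derivative(2)[OF assms] by (simp add: complex_derivative_map_def vec_eq_iff)
    show "complex_derivative_map f z (u + v) = complex_derivative_map f z u + complex_derivative_map f z v" for u v
      using has_derivative_linear[OF D] by (simp add: linear_add)
  qed
qed

lemma complex_differentiable_imp_complex_differentiable_component:
  fixes f :: "complex^'n \<Rightarrow> complex^'m"
  assumes "(f has_derivative f') (at z)" "Vector_Spaces.linear (*s) (*s) f'"
  shows "complex_differentiable (\<lambda>x. f x $ i) z"
  unfolding complex_differentiable_def
proof (intro exI conjI allI)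
  show "((\<lambda>x. f x $ i) has_derivative (\<lambda>v. f' v $ i)) (at z)"
    by (rule bounded_linear.has_derivative[OF bounded_linear_vec_nth assms(1)])
  show "f' (c *s v) $ i = c * f' v $ i" for c v
    using assms(2) by (simp add: vector_linear_iff)
qed

lemma holomorphic_map_on_iff_complex_differentiable:
  fixes f :: "complex^'n \<Rightarrow> complex^'m"
  shows "holomorphic_map_on f \<Omega> \<longleftrightarrow> (\<forall>z\<in>\<Omega>. \<forall>i. complex_differentiable (\<lambda>x. f x $ i) z)"
  unfolding holomorphic_map_on_def
  using complex_differentiable_imp_complex_differentiable_component has_derivative_complex_derivative_map by blast

lemma complex_differentiable_compose:
  fixes f :: "complex^'n \<Rightarrow> complex^'m"
  assumes h: "complex_differentiable h (f z)" and f: "\<And>i. complex_differentiable (\<lambda>x. f x $ i) z"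
  shows "complex_differentiable (\<lambda>x. h (f x)) z" "complex_derivative (\<lambda>x. h (f x)) z v = complex_derivative h (f z) (complex_derivative_map f z v)"
proof -
  note D = has_derivative_compose[OF has_derivative_complex_derivative_map(1)[OF f] complex_differentiable_has_derivative(1)[OF h]]
  have scale: "complex_derivative h (f z) (complex_derivative_map f z (c *s v)) = c * complex_derivative h (f z) (complex_derivative_map f z v)" for c v
    using has_derivative_complex_derivative_map(2)[OF f] by (simp add: vector_linear_iff complex_differentiable_has_derivative(2)[OF h])
  show "complex_differentiable (\<lambda>x. h (f x)) z" "complex_derivative (\<lambda>x. h (f x)) z v = complex_derivative h (f z) (complex_derivative_map f z v)"
    using has_derivative_imp_complex_derivative[OF D scale] by auto
qed

lemma isCont_if_complex_differentiable_components:
  fixes f :: "complex^'n \<Rightarrow> complex^'m"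
  assumes "\<And>i. complex_differentiable (\<lambda>x. f x $ i) z"
  shows "isCont f z"
  using has_derivative_continuous[OF has_derivative_complex_derivative_map(1)[OF assms]] .

lemma continuous_on_if_complex_differentiable: "(\<And>z. z \<in> U \<Longrightarrow> complex_differentiable h z) \<Longrightarrow> continuous_on U h"
  by (intro continuous_at_imp_continuous_on ballI complex_differentiable_imp_isCont)

lemma continuous_on_if_complex_differentiable_components:
  fixes f :: "complex^'n \<Rightarrow> complex^'m"
  assumes "\<And>z i. z \<in> U \<Longrightarrow> complex_differentiable (\<lambda>x. f x $ i) z"
  shows "continuous_on U f"
  using assms by (intro continuous_at_imp_continuous_on ballI isCont_if_complex_differentiable_components)

lemma holomorphic_on_lines_if_complex_differentiable:
  assumes "open V" "\<And>z. z \<in> V \<Longrightarrow> complex_differentiable h z"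
  shows "holomorphic_on_lines h V"
proof
  show "continuous_on V h"
    using assms(2) complex_differentiable_imp_isCont continuous_at_imp_continuous_on by blast
  show "(\<lambda>t. h (z + t *s v)) holomorphic_on ball 0 1"
    if "\<And>t. t \<in> cball 0 1 \<Longrightarrow> z + t *s v \<in> V" for z v
    by (rule holomorphic_along_line) (use assms(2) that in auto)
qed (rule assms)

text \<open>
  The Weierstrass convergence theorem; restriction to complex lines reduces it to one variable.
\<close>

theorem complex_differentiable_uniform_limit:
  assumes V: "open V" and q: "\<forall>\<^sub>F n in F. \<forall>z\<in>V. complex_differentiable (q n) z"
    and lim: "uniform_limit V q g F" and F: "F \<noteq> bot" and z: "z \<in> V"
  shows "complex_differentiable g z"
proof -
  have "holomorphic_on_lines g V"
  proof
    have "\<forall>\<^sub>F n in F. continuous_on V (q n)"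
      using q by eventually_elim (auto intro: complex_differentiable_imp_isCont continuous_at_imp_continuous_on)
    then show "continuous_on V g"
      by (rule uniform_limit_theorem[OF _ lim F])
    fix z v assume in_V: "\<And>t. t \<in> cball 0 1 \<Longrightarrow> z + t *s v \<in> V"
    have "\<forall>\<^sub>F n in F. continuous_on (cball 0 1) (\<lambda>t. q n (z + t *s v)) \<and>
        (\<lambda>t. q n (z + t *s v)) holomorphic_on ball 0 1"
      using q
    proof eventually_elim
      case (elim n)
      have "(\<lambda>t. q n (z + t *s v)) holomorphic_on cball 0 1"
        by (rule holomorphic_along_line) (use elim in_V in auto)
      then show ?case
        using holomorphic_on_imp_continuous_on holomorphic_on_subset ball_subset_cball by blast
    qed
    moreover have "uniform_limit (cball 0 1) (\<lambda>n t. q n (z + t *s v)) (\<lambda>t. g (z + t *s v)) F"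
      by (rule uniform_limit_compose'[OF lim]) (use in_V in auto)
    ultimately
    show "(\<lambda>t. g (z + t *s v)) holomorphic_on ball 0 1"
      by (rule holomorphic_uniform_limit[OF _ _ F])
  qed (rule V)
  then show ?thesis
    using holomorphic_on_lines.complex_differentiable_if_holomorphic_on_lines z by blast
qed

theorem complex_differentiable_complex_derivative:
  assumes V: "open V" and h: "\<And>z. z \<in> V \<Longrightarrow> complex_differentiable h z" and a: "a \<in> V"
  shows "complex_differentiable (\<lambda>z. complex_derivative h z v) a"
proof -
  interpret holomorphic_on_lines h V
    by (rule holomorphic_on_lines_if_complex_differentiable[OF V h])
  obtain r M where r: "0 < r" "cball a (2 * r) \<subseteq> V" "0 \<le> M" "\<And>z. z \<in> cball a (2 * r) \<Longrightarrow> cmod (h z) \<le> M"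
    using local_bound[OF a] by blast
  have lim: "uniform_limit (ball a r) (\<lambda>n z. of_nat (Suc n) * (h (z + (1 / of_nat (Suc n)) *s v) - h z))
           (\<lambda>z. complex_derivative h z v) sequentially"
    by (rule uniform_limit_on_subset[OF uniform_limit_difference_quotient[OF r(2,1,3,4)]]) auto
  show ?thesis
  proof (rule complex_differentiable_uniform_limit[OF open_ball _ lim])
    show "\<forall>\<^sub>F n in sequentially. \<forall>z\<in>ball a r.
        complex_differentiable (\<lambda>z. of_nat (Suc n) * (h (z + (1 / of_nat (Suc n)) *s v) - h z)) z"
      using eventually_small_step[OF r(1), of v]
    proof eventually_elim
      case (elim n)
      define w where "w = (1 / of_nat (Suc n)) *s v"
      have "complex_differentiable (\<lambda>z. of_nat (Suc n) * (h (z + w) - h z)) z" if z: "z \<in> ball a r" for z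
      proof -
        have "dist a (z + w) \<le> 2 * r"
          using z elim norm_triangle_ineq4[of "a - z" w] by (simp add: w_def dist_norm algebra_simps)
        then have "complex_differentiable h (z + w)" using r(2) h by auto
        then have "complex_differentiable (\<lambda>z. h (z + w)) z"
          by (rule complex_differentiable_compose) (auto simp: )
        moreover have "z \<in> V" using r z by (auto simp: subset_iff)
        then have "complex_differentiable h z" by (rule h)
        ultimately show ?thesis by (intro complex_differentiable_mult complex_differentiable_diff complex_differentiable_const)
      qed
      then show ?case unfolding w_def by blast
    qed
  qed (use r in auto)
qed

section \<open>A weighted Rado theorem in several variables\<close>

text \<open>
  It suffices to show that \<open>h\<close> is holomorphic on complex lines. If \<open>j\<close> does not vanish
  identically on a line, this is the one-variable theorem. Otherwise, by density, the line is a limit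
  of parallel lines of the first kind, along which \<open>h\<close> converges uniformly.
\<close>

theorem Rado_with_weight_several_variables:
  fixes h j :: "complex^'n \<Rightarrow> complex"
  assumes V: "open V" and conth: "continuous_on V h" and contj: "continuous_on V j"
    and h: "\<And>z. z \<in> V \<Longrightarrow> j z \<noteq> 0 \<Longrightarrow> complex_differentiable h z" and j: "\<And>z. z \<in> V \<Longrightarrow> j z \<noteq> 0 \<Longrightarrow> complex_differentiable j z"
    and dense: "V \<subseteq> closure {z \<in> V. j z \<noteq> 0}"
    and a: "a \<in> V"
  shows "complex_differentiable h a"
proof -
  have line: "(\<lambda>t. h (z + t *s v)) holomorphic_on ball 0 1"
    if in_V: "\<And>t. t \<in> cball 0 1 \<Longrightarrow> z + t *s v \<in> V" and s: "s \<in> ball 0 1" "j (z + s *s v) \<noteq> 0" for z v s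
  proof (rule Rado_with_weight[where j = "\<lambda>t. j (z + t *s v)"])
    show "continuous_on (cball 0 1) (\<lambda>t. h (z + t *s v))" "continuous_on (cball 0 1) (\<lambda>t. j (z + t *s v))"
      by (rule continuous_on_compose2[OF conth] continuous_on_compose2[OF contj];
          use in_V in \<open>auto intro!: continuous_intros\<close>)+
    show "(\<lambda>t. h (z + t *s v)) holomorphic_on {t \<in> ball 0 1. j (z + t *s v) \<noteq> 0}"
      "(\<lambda>t. j (z + t *s v)) holomorphic_on {t \<in> ball 0 1. j (z + t *s v) \<noteq> 0}"
      by (rule holomorphic_along_line; use in_V h j in auto)+
    show "{t \<in> ball 0 1. j (z + t *s v) \<noteq> 0} \<noteq> {}"
      using s by blast
  qed
  \<comment> \<open>Lines inside the ball of radius \<open>R\<close> have parallel translates inside the ball of radius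
    \<open>2 * R\<close>, on which \<open>h\<close> is uniformly continuous.\<close>
  obtain R where R: "0 < R" "cball a (2 * R) \<subseteq> V"
  proof -
    obtain R where "0 < R" "cball a R \<subseteq> V"
      using V a open_contains_cball by blast
    then show thesis using that[of "R / 2"] by simp
  qed
  have unif: "uniformly_continuous_on (cball a (2 * R)) h"
    by (rule compact_uniformly_continuous[OF continuous_on_subset[OF conth R(2)] compact_cball])
  have "holomorphic_on_lines h (ball a R)"
  proof
    show "continuous_on (ball a R) h"
      by (rule continuous_on_subset[OF conth]) (use R in auto)
    fix z v assume in_ball: "\<And>t. t \<in> cball 0 1 \<Longrightarrow> z + t *s v \<in> ball a R"
    have z: "z \<in> ball a R" using in_ball[of 0] by simp
    then have "z \<in> V" using R by (auto simp: subset_iff)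
    then have "z \<in> closure {z \<in> V. j z \<noteq> 0}" using dense by blast
    then obtain w where w: "\<And>n. w n \<in> V" "\<And>n. j (w n) \<noteq> 0" "w \<longlonglongrightarrow> z"
      unfolding closure_sequential by blast
    have near: "w n + t *s v \<in> cball a (2 * R)" if "dist (w n) z < R" "t \<in> cball 0 1" for n t
    proof -
      have "dist a (w n + t *s v) \<le> dist a (z + t *s v) + dist (w n) z"
        using dist_triangle[of a "w n + t *s v" "z + t *s v"] by (simp add: dist_norm norm_minus_commute)
      then show ?thesis using in_ball[OF that(2)] that(1) by simp
    qed
    have ev: "\<forall>\<^sub>F n in sequentially. dist (w n) z < e" if "0 < e" for e
      using tendstoD[OF w(3) that] .
    have hol: "\<forall>\<^sub>F n in sequentially. continuous_on (cball 0 1) (\<lambda>t. h (w n + t *s v)) \<and>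
        (\<lambda>t. h (w n + t *s v)) holomorphic_on ball 0 1"
      using ev[OF R(1)]
    proof eventually_elim
      case (elim n)
      have "continuous_on (cball 0 1) (\<lambda>t. h (w n + t *s v))"
        by (rule continuous_on_compose2[OF conth]) (use near[OF elim] R in \<open>auto intro!: continuous_intros\<close>)
      moreover have "(\<lambda>t. h (w n + t *s v)) holomorphic_on ball 0 1"
        by (rule line[where s = 0]) (use near[OF elim] R w in auto)
      ultimately show ?case ..
    qed
    have lim: "uniform_limit (cball 0 1) (\<lambda>n t. h (w n + t *s v)) (\<lambda>t. h (z + t *s v)) sequentially"
    proof (rule uniform_limitI)
      fix e :: real assume "0 < e"
      then obtain d where d: "0 < d" "\<And>x y. x \<in> cball a (2 * R) \<Longrightarrow> y \<in> cball a (2 * R) \<Longrightarrow> dist y x < d \<Longrightarrow> dist (h y) (h x) < e"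
        using unif unfolding uniformly_continuous_on_def by metis
      from ev[OF R(1)] ev[OF d(1)]
      show "\<forall>\<^sub>F n in sequentially. \<forall>t\<in>cball 0 1. dist (h (w n + t *s v)) (h (z + t *s v)) < e"
      proof eventually_elim
        case (elim n)
        show ?case
        proof
          fix t :: complex assume t: "t \<in> cball 0 1"
          have "z + t *s v \<in> cball a (2 * R)" using in_ball[OF t] R by auto
          then show "dist (h (w n + t *s v)) (h (z + t *s v)) < e"
            by (rule d(2)) (use near[OF elim(1) t] elim(2) in \<open>auto simp: dist_norm\<close>)
        qed
      qed
    qed
    show "(\<lambda>t. h (z + t *s v)) holomorphic_on ball 0 1"
      by (rule holomorphic_uniform_limit[OF hol lim sequentially_bot])
  qed simp
  then show ?thesis
    using R(1) by (simp add: holomorphic_on_lines.complex_differentiable_if_holomorphic_on_lines)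
qed

section \<open>Injective holomorphic maps have holomorphic inverses\<close>

lemma complex_differentiable_local_inverse:
  fixes F g :: "complex^'n \<Rightarrow> complex^'n"
  assumes F: "\<And>i. complex_differentiable (\<lambda>x. F x $ i) (g y)"
    and inj: "\<And>v. complex_derivative_map F (g y) v = 0 \<Longrightarrow> v = 0"
    and cont: "isCont g y" and T: "open T" "y \<in> T" "\<And>z. z \<in> T \<Longrightarrow> F (g z) = z"
  shows "complex_differentiable (\<lambda>x. g x $ i) y"
proof -
  let ?L = "complex_derivative_map F (g y)"
  note D = has_derivative_complex_derivative_map[OF F]
  have lin: "linear ?L" by (rule has_derivative_linear[OF D(1)])
  then have "inj ?L" using inj by (simp add: linear_injective_0)
  then obtain g' where g': "linear g'" "\<And>x. g' (?L x) = x" "\<And>x. ?L (g' x) = x"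
    using linear_injective_isomorphism[OF lin] by blast
  have "(g has_derivative g') (at y)"
    by (rule has_derivative_inverse_basic[OF D(1) _ _ cont T])
       (use g' in \<open>auto simp: linear_conv_bounded_linear\<close>)
  moreover have "Vector_Spaces.linear (*s) (*s) g'"
  proof -
    have "g' (c *s v) = c *s g' v" for c v
    proof -
      have "g' (c *s v) = g' (c *s ?L (g' v))" by (simp add: g')
      also have "\<dots> = g' (?L (c *s g' v))" using D(2) by (simp add: vector_linear_iff)
      finally show ?thesis by (simp add: g')
    qed
    then show ?thesis using linear_add[OF g'(1)] by (simp add: vector_linear_iff)
  qed
  ultimately show ?thesis by (rule complex_differentiable_imp_complex_differentiable_component)
qed

text \<open>
  If the derivative were singular everywhere, the image would be a null set by Sard's theorem, but it
  is open by invariance of domain. The real coordinates of \<open>complex^'n\<close> are indexed by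
  \<open>'n bit0\<close>, a type with twice as many elements as \<open>'n\<close>; it carries the well-order that
  \<open>baby_Sard\<close> asks of its index types.
\<close>

lemma injective_holomorphic_has_nonsingular_point:
  fixes F :: "complex^'n \<Rightarrow> complex^'n"
  assumes O: "open U" "U \<noteq> {}" and F: "\<And>z i. z \<in> U \<Longrightarrow> complex_differentiable (\<lambda>x. F x $ i) z" and inj: "inj_on F U"
  shows "\<exists>z\<in>U. \<forall>v. complex_derivative_map F z v = 0 \<longrightarrow> v = 0"
proof (rule ccontr)
  assume "\<not> ?thesis"
  then have "\<forall>z\<in>U. \<exists>v. v \<noteq> 0 \<and> complex_derivative_map F z v = 0" by blast
  then obtain v where v: "\<And>z. z \<in> U \<Longrightarrow> v z \<noteq> 0" "\<And>z. z \<in> U \<Longrightarrow> complex_derivative_map F z (v z) = 0" by metis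
  have "DIM(complex^'n) = DIM(real^'n bit0)" by simp
  then obtain T :: "complex^'n \<Rightarrow> real^'n bit0" and T' where T: "linear T" "linear T'" 
    "\<And>x. T' (T x) = x" "\<And>x. T (T' x) = x"
    using isomorphisms_UNIV_UNIV[where 'M = "complex^'n" and 'N = "real^'n bit0"] by metis
  have blT: "bounded_linear T" "bounded_linear T'" using T by (simp_all add: linear_conv_bounded_linear)
  define S where "S = T' -` U"
  have opS: "open S"
    unfolding S_def by (rule continuous_open_vimage[OF O(1)]) (rule linear_continuous_at[OF blT(2)])
  have "S \<noteq> {}" using O(2) T(3) by (auto simp: S_def)
  let ?H = "\<lambda>x. T (F (T' x))"
  have der: "(?H has_derivative (\<lambda>h. T (complex_derivative_map F (T' x) (T' h)))) (at x)" if "x \<in> S" for x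
  proof -
    have "T' x \<in> U" using that by (simp add: S_def)
    then have "(F has_derivative complex_derivative_map F (T' x)) (at (T' x))" by (intro has_derivative_complex_derivative_map F)
    from has_derivative_compose[OF bounded_linear_imp_has_derivative[OF blT(2)] this]
    show ?thesis by (rule bounded_linear.has_derivative[OF blT(1)])
  qed
  have "negligible (?H ` S)"
  proof (rule baby_Sard[where f' = "\<lambda>x h. T (complex_derivative_map F (T' x) (T' h))"])
    fix x assume x: "x \<in> S"
    show "(?H has_derivative (\<lambda>h. T (complex_derivative_map F (T' x) (T' h)))) (at x within S)"
      using der[OF x] by (rule has_derivative_at_withinI)
    let ?M = "matrix (\<lambda>h. T (complex_derivative_map F (T' x) (T' h)))"
    have U: "T' x \<in> U" using x by (simp add: S_def)
    have "?M *v T (v (T' x)) = T (complex_derivative_map F (T' x) (T' (T (v (T' x)))))"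
      by (rule fun_cong[OF matrix_vector_mul(2)]) (rule has_derivative_linear[OF der[OF x]])
    also have "\<dots> = 0" using v(2)[OF U] by (simp add: T linear_0)
    finally have "?M *v T (v (T' x)) = ?M *v 0" by simp
    moreover have "T (v (T' x)) \<noteq> 0" using v(1)[OF U] T(3) linear_0[OF T(2)] by metis
    ultimately have "\<not> inj ((*v) ?M)" by (metis injD)
    then have "rank ?M \<noteq> CARD('n bit0)" using full_rank_injective[of ?M] by simp
    moreover have "rank ?M \<le> CARD('n bit0)" using rank_bound[of ?M] by simp
    ultimately show "rank ?M < CARD('n bit0)" by simp
  qed simp
  moreover have "open (?H ` S)"
  proof (rule invariance_of_domain[OF _ opS])
    show "continuous_on S ?H"
      using der has_derivative_continuous continuous_at_imp_continuous_on by blast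
    show "inj_on ?H S"
    proof (rule inj_onI)
      fix x y assume xy: "x \<in> S" "y \<in> S" "?H x = ?H y"
      then have "F (T' x) = F (T' y)" by (metis T(3))
      then have "T' x = T' y" using inj xy by (auto simp: S_def dest: inj_onD)
      then show "x = y" by (metis T(4))
    qed
  qed
  ultimately show False
    using \<open>S \<noteq> {}\<close> open_not_negligible by blast
qed

definition jacobian_det :: "(complex^'n \<Rightarrow> complex^'n) \<Rightarrow> complex^'n \<Rightarrow> complex" where
  "jacobian_det F z = det (\<chi> i k. complex_derivative (\<lambda>x. F x $ i) z (axis k 1))"

lemma complex_derivative_map_eq_matrix:
  fixes F :: "complex^'n \<Rightarrow> complex^'n"
  assumes "\<And>i. complex_differentiable (\<lambda>x. F x $ i) z"
  shows "complex_derivative_map F z = (*v) (\<chi> i k. complex_derivative (\<lambda>x. F x $ i) z (axis k 1))"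
proof
  fix v
  have lin: "linear (complex_derivative (\<lambda>x. F x $ i) z)" for i
    by (rule has_derivative_linear[OF complex_differentiable_has_derivative(1)[OF assms]])
  have axis: "axis k c = c *s (axis k 1 :: complex^'n)" for k c
    by (simp add: vec_eq_iff axis_def)
  have "complex_derivative (\<lambda>x. F x $ i) z v = (\<Sum>k\<in>UNIV. complex_derivative (\<lambda>x. F x $ i) z (axis k 1) * v $ k)" for i
  proof -
    have "complex_derivative (\<lambda>x. F x $ i) z v = complex_derivative (\<lambda>x. F x $ i) z (\<Sum>k\<in>UNIV. axis k (v $ k))"
      by (simp flip: vec_eq_sum_axis)
    also have "\<dots> = (\<Sum>k\<in>UNIV. complex_derivative (\<lambda>x. F x $ i) z (v $ k *s axis k 1))"
      by (subst axis) (simp add: linear_sum[OF lin])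
    finally show ?thesis
      by (simp add: complex_differentiable_has_derivative(2)[OF assms] mult.commute)
  qed
  then show "complex_derivative_map F z v = (\<chi> i k. complex_derivative (\<lambda>x. F x $ i) z (axis k 1)) *v v"
    by (simp add: complex_derivative_map_def matrix_vector_mult_def vec_eq_iff)
qed

lemma jacobian_det_nonzero_iff:
  fixes F :: "complex^'n \<Rightarrow> complex^'n"
  assumes "\<And>i. complex_differentiable (\<lambda>x. F x $ i) z"
  shows "jacobian_det F z \<noteq> 0 \<longleftrightarrow> (\<forall>v. complex_derivative_map F z v = 0 \<longrightarrow> v = 0)"
proof -
  let ?A = "\<chi> i k. complex_derivative (\<lambda>x. F x $ i) z (axis k 1)"
  have "jacobian_det F z \<noteq> 0 \<longleftrightarrow> invertible ?A"
    by (simp add: jacobian_det_def invertible_det_nz)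
  also have "\<dots> \<longleftrightarrow> (\<exists>B. B ** ?A = mat 1)"
    by (rule invertible_left_inverse)
  also have "\<dots> \<longleftrightarrow> (\<forall>v. ?A *v v = 0 \<longrightarrow> v = 0)"
    by (rule matrix_left_invertible_ker)
  finally show ?thesis by (simp add: complex_derivative_map_eq_matrix[OF assms])
qed

text \<open>
  The partial derivatives of a holomorphic function are holomorphic.
\<close>

lemma complex_differentiable_jacobian_det:
  fixes F :: "complex^'n \<Rightarrow> complex^'n"
  assumes "open U" "\<And>z i. z \<in> U \<Longrightarrow> complex_differentiable (\<lambda>x. F x $ i) z" "z \<in> U"
  shows "complex_differentiable (jacobian_det F) z"
proof -
  have "complex_differentiable (\<lambda>z. complex_derivative (\<lambda>x. F x $ i) z v) z" for i v
    by (rule complex_differentiable_complex_derivative[OF assms(1) assms(2) assms(3)])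
  then have "complex_differentiable (\<lambda>z. \<Sum>p\<in>{p. p permutes UNIV}. of_int (sign p) *
      (\<Prod>i\<in>UNIV. complex_derivative (\<lambda>x. F x $ i) z (axis (p i) 1))) z"
    by (intro complex_differentiable_sum complex_differentiable_mult complex_differentiable_prod complex_differentiable_const)
  then show ?thesis
    by (simp add: jacobian_det_def[abs_def] det_def)
qed

text \<open>
  Osgood's theorem. The inverse \<open>g\<close> is continuous by invariance of domain and complex
  differentiable wherever \<open>j\<close>, the Jacobian determinant transported by \<open>g\<close>, does not vanish;
  there \<open>j\<close> is complex differentiable as well. So the weighted Rado theorem applies to the
  components of \<open>g\<close>.
\<close>

theorem injective_holomorphic_imp_holomorphic_inverse:
  fixes F g :: "complex^'n \<Rightarrow> complex^'n"
  assumes U: "open U" and F: "\<And>z i. z \<in> U \<Longrightarrow> complex_differentiable (\<lambda>x. F x $ i) z" and inj: "inj_on F U"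
    and g: "\<And>x. x \<in> U \<Longrightarrow> g (F x) = x"
  shows "open (F ` U)" "\<And>y i. y \<in> F ` U \<Longrightarrow> complex_differentiable (\<lambda>x. g x $ i) y"
proof -
  have contF: "continuous_on U F"
    by (rule continuous_on_if_complex_differentiable_components[OF F])
  show opV: "open (F ` U)" by (rule invariance_of_domain[OF contF U inj])
  have contg: "continuous_on (F ` U) g"
    by (rule continuous_on_inverse_open[OF U contF _ g]) simp_all
  define j where "j y = jacobian_det F (g y)" for y
  have J: "complex_differentiable (jacobian_det F) z" if "z \<in> U" for z
    by (rule complex_differentiable_jacobian_det[OF U F that])
  have g_complex_differentiable: "complex_differentiable (\<lambda>x. g x $ i) y" if y: "y \<in> F ` U" "j y \<noteq> 0" for y i
  proof (rule complex_differentiable_local_inverse[OF _ _ _ opV y(1)])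
    have gy: "g y \<in> U" using y(1) g by auto
    show "complex_differentiable (\<lambda>x. F x $ k) (g y)" for k using F gy by blast
    show "v = 0" if "complex_derivative_map F (g y) v = 0" for v
      using y(2) that jacobian_det_nonzero_iff[OF F[OF gy]] by (simp add: j_def)
    show "isCont g y" using contg opV y(1) continuous_on_eq_continuous_at by blast
    show "F (g z) = z" if "z \<in> F ` U" for z using that g by auto
  qed
  fix y i assume "y \<in> F ` U"
  then show "complex_differentiable (\<lambda>x. g x $ i) y"
  proof (rule Rado_with_weight_several_variables[OF opV, where j = j, rotated -1])
    show "continuous_on (F ` U) (\<lambda>x. g x $ i)"
      using contg by (intro continuous_intros)
    have "continuous_on U (jacobian_det F)"
      by (rule continuous_on_if_complex_differentiable[OF J])
    then show "continuous_on (F ` U) j"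
      unfolding j_def by (rule continuous_on_compose2[OF _ contg]) (use g in auto)
    show "complex_differentiable (\<lambda>x. g x $ i) y" if "y \<in> F ` U" "j y \<noteq> 0" for y
      using g_complex_differentiable that by blast
    show "complex_differentiable j y" if y: "y \<in> F ` U" "j y \<noteq> 0" for y
      unfolding j_def by (rule complex_differentiable_compose(1)[OF J g_complex_differentiable[OF y]]) (use y g in auto)
    show "F ` U \<subseteq> closure {y \<in> F ` U. j y \<noteq> 0}"
    proof
      fix y assume "y \<in> F ` U"
      then obtain x where x: "x \<in> U" "y = F x" by blast
      show "y \<in> closure {y \<in> F ` U. j y \<noteq> 0}"
        unfolding closure_iff_nhds_not_empty
      proof (intro allI impI)
        fix A B assume A: "B \<subseteq> A" "open B" "y \<in> B"
        have op: "open (U \<inter> F -` B)" by (rule continuous_open_preimage[OF contF U A(2)])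
        have "U \<inter> F -` B \<noteq> {}" using x A by auto
        then have "\<exists>z\<in>U \<inter> F -` B. \<forall>v. complex_derivative_map F z v = 0 \<longrightarrow> v = 0"
          by (intro injective_holomorphic_has_nonsingular_point[OF op] F)
             (use inj in \<open>auto intro: inj_on_subset\<close>)
        then obtain z where z: "z \<in> U" "F z \<in> B" "\<And>v. complex_derivative_map F z v = 0 \<Longrightarrow> v = 0" by blast
        then have "j (F z) \<noteq> 0"
          using jacobian_det_nonzero_iff[OF F[OF z(1)]] by (simp add: j_def g)
        then show "{y \<in> F ` U. j y \<noteq> 0} \<inter> A \<noteq> {}" using z A by auto
      qed
    qed
  qed
qed

section \<open>Polynomials as functions\<close>

lemma poly_eval_eq_sum:
  assumes "finite S" "Poly_Mapping.keys p \<subseteq> S"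
  shows "poly_eval p z = (\<Sum>m\<in>S. Poly_Mapping.lookup p m * (\<Prod>i\<in>UNIV. z $ i ^ Poly_Mapping.lookup m i))"
  unfolding poly_eval_def poly_subst_def id_def
  by (rule sum.mono_neutral_left) (use assms in \<open>auto simp: in_keys_iff\<close>)

lemma poly_eval_single:
  "poly_eval (Poly_Mapping.single m c) z = c * (\<Prod>i\<in>UNIV. z $ i ^ Poly_Mapping.lookup m i)"
  by (subst poly_eval_eq_sum[of "{m}"]) auto

lemma poly_eval_0 [simp]: "poly_eval 0 z = 0"
  by (simp add: poly_eval_def poly_subst_def)

lemma poly_eval_add [simp]: "poly_eval (p + q) z = poly_eval p z + poly_eval q z"
proof -
  have "Poly_Mapping.keys (p + q) \<subseteq> Poly_Mapping.keys p \<union> Poly_Mapping.keys q"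
    by (rule Poly_Mapping.keys_add)
  then show ?thesis
    by (simp add: poly_eval_eq_sum[where S = "Poly_Mapping.keys p \<union> Poly_Mapping.keys q"]
        lookup_add distrib_right sum.distrib)
qed

lemma poly_eval_sum [simp]: "poly_eval (\<Sum>a\<in>I. p a) z = (\<Sum>a\<in>I. poly_eval (p a) z)"
  by (induction I rule: infinite_finite_induct) auto

lemma poly_eval_mult [simp]: "poly_eval (p * q) z = poly_eval p z * poly_eval q z"
proof -
  have single: "poly_eval (Poly_Mapping.single m c * Poly_Mapping.single n d) z
      = poly_eval (Poly_Mapping.single m c) z * poly_eval (Poly_Mapping.single n d) z" for m n c d
    by (simp add: mult_single poly_eval_single lookup_add power_add prod.distrib)
  have p: "p = (\<Sum>m\<in>Poly_Mapping.keys p. Poly_Mapping.single m (Poly_Mapping.lookup p m))" for p :: "'a cpoly"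
    by (rule poly_mapping_eqI) (simp add: lookup_sum lookup_single when_def in_keys_iff)
  show ?thesis
    by (subst (1 2 3 4) p) (simp only: sum_product poly_eval_sum single)
qed

lemma poly_eval_const [simp]: "poly_eval (Poly_Mapping.single 0 c) z = c"
  by (simp add: poly_eval_single)

lemma poly_eval_1 [simp]: "poly_eval 1 z = 1"
  using poly_eval_const[of 1 z] by (simp add: single_one)

lemma poly_eval_variable: "poly_eval (Poly_Mapping.single (Poly_Mapping.single i 1) 1) z = z $ i"
proof -
  have "(\<Prod>k\<in>UNIV. z $ k ^ Poly_Mapping.lookup (Poly_Mapping.single i 1) k) = (\<Prod>k\<in>UNIV. if k = i then z $ i else 1)"
    by (rule prod.cong) (auto simp: lookup_single when_def)
  then show ?thesis by (simp add: poly_eval_single)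
qed

lemma poly_eval_prod [simp]: "poly_eval (\<Prod>a\<in>I. p a) z = (\<Prod>a\<in>I. poly_eval (p a) z)"
  by (induction I rule: infinite_finite_induct) auto

lemma poly_eval_power [simp]: "poly_eval (p ^ k) z = poly_eval p z ^ k"
  by (induction k) auto

lemma poly_eval_compose: "poly_eval (poly_compose p \<theta>) z = poly_eval p (poly_map \<theta> z)"
  unfolding poly_compose_def poly_subst_def
  by (simp add: poly_eval_def[of p] poly_subst_def poly_map_def)

lemma complex_differentiable_poly_eval: "complex_differentiable (poly_eval p) z"
proof -
  have "poly_eval p = (\<lambda>z. \<Sum>m\<in>Poly_Mapping.keys p. Poly_Mapping.lookup p m * (\<Prod>i\<in>UNIV. z $ i ^ Poly_Mapping.lookup m i))"
    by (rule ext) (simp add: poly_eval_def poly_subst_def)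
  then show ?thesis
    by (auto intro!: complex_differentiable_sum complex_differentiable_mult complex_differentiable_prod complex_differentiable_power)
qed

definition polynomial_fun :: "(complex^'n \<Rightarrow> complex) \<Rightarrow> bool" where
  "polynomial_fun f \<longleftrightarrow> (\<exists>p. f = poly_eval p)"

lemma polynomial_fun_const: "polynomial_fun (\<lambda>z. c)"
  unfolding polynomial_fun_def by (rule exI[of _ "Poly_Mapping.single 0 c"]) auto

lemma polynomial_fun_component: "polynomial_fun (\<lambda>z. z $ i)"
  unfolding polynomial_fun_def
  by (rule exI[of _ "Poly_Mapping.single (Poly_Mapping.single i 1) 1"]) (rule ext, rule poly_eval_variable[symmetric])

lemma polynomial_fun_add: "polynomial_fun f \<Longrightarrow> polynomial_fun g \<Longrightarrow> polynomial_fun (\<lambda>z. f z + g z)"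
  unfolding polynomial_fun_def
proof (elim exE)
  fix p q assume "f = poly_eval p" "g = poly_eval q"
  then have "(\<lambda>z. f z + g z) = poly_eval (p + q)" by (simp add: fun_eq_iff)
  then show "\<exists>r. (\<lambda>z. f z + g z) = poly_eval r" by blast
qed

lemma polynomial_fun_mult: "polynomial_fun f \<Longrightarrow> polynomial_fun g \<Longrightarrow> polynomial_fun (\<lambda>z. f z * g z)"
  unfolding polynomial_fun_def
proof (elim exE)
  fix p q assume "f = poly_eval p" "g = poly_eval q"
  then have "(\<lambda>z. f z * g z) = poly_eval (p * q)" by (simp add: fun_eq_iff)
  then show "\<exists>r. (\<lambda>z. f z * g z) = poly_eval r" by blast
qed

lemma polynomial_fun_diff: "polynomial_fun f \<Longrightarrow> polynomial_fun g \<Longrightarrow> polynomial_fun (\<lambda>z. f z - g z)"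
  using polynomial_fun_add[OF _ polynomial_fun_mult[OF polynomial_fun_const[of "-1"]]] by fastforce

lemma polynomial_fun_sum: "(\<And>i. i \<in> I \<Longrightarrow> polynomial_fun (f i)) \<Longrightarrow> polynomial_fun (\<lambda>z. \<Sum>i\<in>I. f i z)"
  by (induction I rule: infinite_finite_induct) (auto intro: polynomial_fun_const polynomial_fun_add)

lemma polynomial_fun_prod: "(\<And>i. i \<in> I \<Longrightarrow> polynomial_fun (f i)) \<Longrightarrow> polynomial_fun (\<lambda>z. \<Prod>i\<in>I. f i z)"
  by (induction I rule: infinite_finite_induct) (auto intro: polynomial_fun_const polynomial_fun_mult)

lemma polynomial_fun_matrix_component: "polynomial_fun (\<lambda>z. (B *v z) $ i)"
  unfolding matrix_vector_mult_def vec_lambda_beta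
  by (intro polynomial_fun_sum polynomial_fun_mult polynomial_fun_const polynomial_fun_component)

text \<open>
  The coefficients are elementary symmetric polynomials in the \<open>f a\<close>; the recursion of the
  coefficients under multiplication by a linear factor avoids writing them out.
\<close>

lemma polynomial_fun_coeff_prod_linear:
  assumes "\<And>a. a \<in> I \<Longrightarrow> polynomial_fun (f a)"
  shows "polynomial_fun (\<lambda>z. coeff (\<Prod>a\<in>I. [:- f a z, 1:]) k)"
  using assms
proof (induction I arbitrary: k rule: infinite_finite_induct)
  case (insert a I)
  let ?c = "\<lambda>k z. coeff (\<Prod>a\<in>I. [:- f a z, 1:]) k"
  have eq: "(\<lambda>z. coeff (\<Prod>a\<in>insert a I. [:- f a z, 1:]) k) =
      (\<lambda>z. (case k of 0 \<Rightarrow> 0 | Suc l \<Rightarrow> ?c l z) - f a z * ?c k z)"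
    using insert by (simp add: coeff_pCons fun_eq_iff split: nat.split)
  have "polynomial_fun (\<lambda>z. case k of 0 \<Rightarrow> 0 | Suc l \<Rightarrow> ?c l z)"
    using insert by (cases k) (simp_all add: polynomial_fun_const)
  moreover have "polynomial_fun (\<lambda>z. f a z * ?c k z)"
    using insert by (intro polynomial_fun_mult) auto
  ultimately show ?case
    unfolding eq by (rule polynomial_fun_diff)
qed (auto intro: polynomial_fun_const)

text \<open>
  For \<open>cmod x > 1\<close> the lower terms are at most \<open>cmod x ^ (degree p - 1)\<close> times the sum of the
  coefficient moduli.
\<close>

lemma monic_root_bound:
  fixes p :: "complex poly"
  assumes monic: "lead_coeff p = 1" and root: "poly p x = 0"
  shows "cmod x \<le> 1 + (\<Sum>k<degree p. cmod (coeff p k))"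
proof (cases "cmod x \<le> 1")
  case True
  then show ?thesis by (simp add: add_increasing2 sum_nonneg)
next
  case False
  define N where "N = degree p"
  have "N \<noteq> 0"
  proof
    assume "N = 0"
    then obtain c where "p = [:c:]" using degree_eq_zeroE N_def by metis
    with monic root show False by simp
  qed
  then obtain K where K: "N = Suc K" by (cases N) auto
  have "(\<Sum>k\<le>N. coeff p k * x ^ k) = 0"
    using root by (simp add: poly_altdef N_def)
  then have "(\<Sum>k<N. coeff p k * x ^ k) + x ^ N = 0"
    using monic by (simp add: N_def lessThan_Suc_atMost[symmetric])
  then have "x ^ N = - (\<Sum>k<N. coeff p k * x ^ k)"
    by (simp add: add_eq_0_iff2)
  then have "cmod x ^ N = cmod (\<Sum>k<N. coeff p k * x ^ k)"
    by (metis norm_minus_cancel norm_power)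
  also have "\<dots> \<le> (\<Sum>k<N. cmod (coeff p k) * cmod x ^ K)"
  proof (rule sum_norm_le)
    fix k assume "k \<in> {..<N}"
    then have "cmod x ^ k \<le> cmod x ^ K"
      using False K by (intro power_increasing) auto
    then show "cmod (coeff p k * x ^ k) \<le> cmod (coeff p k) * cmod x ^ K"
      by (simp add: norm_mult norm_power mult_left_mono)
  qed
  finally have "cmod x * cmod x ^ K \<le> (\<Sum>k<N. cmod (coeff p k)) * cmod x ^ K"
    unfolding K power_Suc sum_distrib_right .
  moreover have "0 < cmod x ^ K" using False by (intro zero_less_power) auto
  ultimately have "cmod x \<le> (\<Sum>k<N. cmod (coeff p k))"
    by (simp add: mult_le_cancel_right)
  then show ?thesis by (simp add: N_def)
qed

lemma continuous_poly_eval: "continuous_on S (poly_eval p)"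
  by (rule continuous_on_if_complex_differentiable[OF complex_differentiable_poly_eval])

lemma closure_diff_countable:
  assumes "countable (C :: complex set)"
  shows "closure (- C) = UNIV"
proof -
  have "interior C = {}"
    using assms countable_subset[OF interior_subset] open_interior uncountable_ball
    by (metis all_not_in_conv countable_subset openE)
  then show ?thesis by (simp add: closure_complement)
qed

text \<open>
  On a complex line the polynomial is an entire function of one variable that is not identically
  zero.
\<close>

lemma poly_eval_nonzero_on_line:
  assumes "poly_eval D w \<noteq> 0"
  shows "countable {t. poly_eval D (w + t *s v) = 0}"
proof -
  have hol: "(\<lambda>t. poly_eval D (w + t *s v)) holomorphic_on UNIV"
    by (rule holomorphic_along_line) (rule complex_differentiable_poly_eval)
  show ?thesis
  proof (cases "(\<lambda>t. poly_eval D (w + t *s v)) constant_on UNIV")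
    case True
    then obtain c where "\<And>t. poly_eval D (w + t *s v) = c" by (auto simp: constant_on_def)
    then have "poly_eval D (w + t *s v) \<noteq> 0" for t
      using assms by (metis add.right_neutral vector_smult_lzero)
    then show ?thesis by simp
  next
    case False
    then show ?thesis
      using holomorphic_countable_zeros[OF hol] by auto
  qed
qed

text \<open>
  Each point lies on a complex line through \<open>a\<close>, and only countably many points of that line are
  zeros.
\<close>

lemma closure_poly_eval_nonzero:
  assumes "poly_eval D a \<noteq> 0"
  shows "closure {w. poly_eval D w \<noteq> 0} = UNIV"
proof -
  have "w \<in> closure {w. poly_eval D w \<noteq> 0}" for w
  proof -
    define L where "L t = a + t *s (w - a)" for t
    define Z where "Z = {t. poly_eval D (L t) = 0}"
    have "countable Z"
      unfolding Z_def L_def by (rule poly_eval_nonzero_on_line[OF assms])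
    then have "closure (- Z) = UNIV" by (rule closure_diff_countable)
    moreover have "L ` closure (- Z) \<subseteq> closure {w. poly_eval D w \<noteq> 0}"
    proof (rule image_closure_subset)
      show "continuous_on (closure (- Z)) L"
        unfolding L_def[abs_def] by (intro continuous_intros)
      show "L ` (- Z) \<subseteq> closure {w. poly_eval D w \<noteq> 0}"
        using closure_subset by (force simp: Z_def)
    qed simp
    ultimately have "L 1 \<in> closure {w. poly_eval D w \<noteq> 0}" by blast
    then show ?thesis by (simp add: L_def)
  qed
  then show ?thesis by blast
qed

definition bilinear_dot :: "complex^'n \<Rightarrow> complex^'n \<Rightarrow> complex" where
  "bilinear_dot u z = (\<Sum>i\<in>UNIV. u $ i * z $ i)"

lemma bilinear_dot_simps:
  "bilinear_dot u (z + w) = bilinear_dot u z + bilinear_dot u w" "bilinear_dot u (z - w) = bilinear_dot u z - bilinear_dot u w"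
  "bilinear_dot u (c *s z) = c * bilinear_dot u z" "bilinear_dot (u + v) z = bilinear_dot u z + bilinear_dot v z" "bilinear_dot (c *s u) z = c * bilinear_dot u z"
  by (simp_all add: bilinear_dot_def sum.distrib sum_subtractf algebra_simps sum_distrib_left)

lemma polynomial_fun_bilinear_dot: "polynomial_fun (\<lambda>z. bilinear_dot u (B *v z))"
  unfolding bilinear_dot_def
  by (intro polynomial_fun_sum polynomial_fun_mult polynomial_fun_const polynomial_fun_matrix_component)

text \<open>
  Finitely many proper linear subspaces do not cover the dual space: a functional that works for
  \<open>V\<close> is perturbed along a coordinate functional not vanishing at the new vector, and only
  finitely many parameters are excluded.
\<close>

lemma exists_functional_nonzero_on:
  fixes V :: "(complex^'n) set"
  assumes "finite V" "0 \<notin> V"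
  shows "\<exists>u. \<forall>v\<in>V. bilinear_dot u v \<noteq> 0"
  using assms
proof (induction V)
  case (insert x V)
  then obtain u where u: "\<And>v. v \<in> V \<Longrightarrow> bilinear_dot u v \<noteq> 0" by auto
  obtain k where k: "x $ k \<noteq> 0" using insert by (auto simp: vec_eq_iff)
  define e where "e = (axis k 1 :: complex^'n)"
  have e: "bilinear_dot e v = v $ k" for v
    by (simp add: e_def bilinear_dot_def axis_def if_distrib[of "\<lambda>c. c * _"] sum.delta cong: if_cong)
  have "finite (insert 0 ((\<lambda>v. - bilinear_dot u v / v $ k) ` insert x V))" (is "finite ?B")
    using insert by simp
  then obtain t where t: "t \<notin> ?B"
    using ex_new_if_finite[OF infinite_UNIV_char_0] by blast
  have "bilinear_dot (u + t *s e) v \<noteq> 0" if v: "v \<in> insert x V" for v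
  proof
    assume "bilinear_dot (u + t *s e) v = 0"
    then have eq: "bilinear_dot u v + t * v $ k = 0" by (simp add: bilinear_dot_simps e)
    show False
    proof (cases "v $ k = 0")
      case True
      then show False using eq u[of v] v k by auto
    next
      case False
      then have "t = - bilinear_dot u v / v $ k"
        using eq by (simp add: field_simps eq_neg_iff_add_eq_0 add.commute)
      with t v show False by blast
    qed
  qed
  then show ?case by blast
qed simp

section \<open>The map given by generators of the invariant ring\<close>

locale invariant_generators =
  fixes G :: "(complex^'n^'n) set" and \<theta> :: "'n \<Rightarrow> 'n cpoly"
  assumes finite_G: "finite G" and subgroup_G: "subgroup G GL"
    and generators: "invariant_polys G = range (\<lambda>p. poly_compose p \<theta>)"
begin

lemma one_in_G: "mat 1 \<in> G"
  using subgroup.one_closed[OF subgroup_G] by (simp add: GL_def)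

lemma mult_in_G: "A \<in> G \<Longrightarrow> B \<in> G \<Longrightarrow> A ** B \<in> G"
  using subgroup.m_closed[OF subgroup_G] by (simp add: GL_def)

lemma inv_in_G:
  assumes "A \<in> G"
  shows "matrix_inv A \<in> G" "matrix_inv A ** A = mat 1" "A ** matrix_inv A = mat 1"
proof -
  have A: "A \<in> carrier GL" using subgroup.mem_carrier[OF subgroup_G assms] .
  show "matrix_inv A \<in> G"
    using subgroup.m_inv_closed[OF subgroup_G assms] by (simp add: inv_GL[OF A])
  show "matrix_inv A ** A = mat 1" "A ** matrix_inv A = mat 1"
    using group.l_inv[OF group_GL A] group.r_inv[OF group_GL A] by (simp_all add: inv_GL[OF A]) (simp_all add: GL_def)
qed

lemma matrix_inv_twice:
  assumes "A \<in> G"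
  shows "matrix_inv (matrix_inv A) = A"
proof -
  have "matrix_inv (matrix_inv A) = matrix_inv (matrix_inv A) ** (matrix_inv A ** A)"
    using inv_in_G(2)[OF assms] by simp
  also have "\<dots> = A"
    using inv_in_G(2)[OF inv_in_G(1)[OF assms]] by (simp add: matrix_mul_assoc)
  finally show ?thesis .
qed

text \<open>
  The group acts through inverses; since inversion permutes \<open>G\<close>, the orbits are those of the
  matrix action.
\<close>

lemma orbit_eq: "{act A z |A. A \<in> G} = (\<lambda>B. B *v z) ` G"
  unfolding act_def using inv_in_G(1) matrix_inv_twice by (auto simp: image_iff) metis

lemma mem_invariant_polys_iff:
  "p \<in> invariant_polys G \<longleftrightarrow> (\<forall>B\<in>G. \<forall>z. poly_eval p (B *v z) = poly_eval p z)"
  unfolding invariant_polys_def act_def using inv_in_G(1) matrix_inv_twice by (auto; metis)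

abbreviation \<Theta> :: "complex^'n \<Rightarrow> complex^'n" where "\<Theta> \<equiv> poly_map \<theta>"

lemma invariant_polynomial_factors:
  assumes "polynomial_fun f" "\<And>B z. B \<in> G \<Longrightarrow> f (B *v z) = f z"
  shows "\<exists>P. \<forall>z. f z = poly_eval P (\<Theta> z)"
proof -
  obtain p where p: "f = poly_eval p" using assms(1) by (auto simp: polynomial_fun_def)
  then have "p \<in> invariant_polys G" using assms(2) by (simp add: mem_invariant_polys_iff)
  then obtain P where "p = poly_compose P \<theta>" using generators by auto
  then show ?thesis using p poly_eval_compose by auto
qed

lemma \<Theta>_invariant:
  assumes "B \<in> G"
  shows "\<Theta> (B *v z) = \<Theta> z"
proof -
  have "poly_eval (\<theta> i) (B *v z) = poly_eval (\<theta> i) z" for i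
  proof -
    let ?x = "Poly_Mapping.single (Poly_Mapping.single i 1) 1 :: 'n cpoly"
    have "poly_compose ?x \<theta> \<in> invariant_polys G" using generators by blast
    then have "poly_eval (poly_compose ?x \<theta>) (B *v z) = poly_eval (poly_compose ?x \<theta>) z"
      using assms by (simp add: mem_invariant_polys_iff)
    then show ?thesis
      unfolding poly_eval_compose poly_eval_variable by (simp add: poly_map_def)
  qed
  then show ?thesis by (simp add: poly_map_def)
qed

lemma complex_differentiable_\<Theta>: "complex_differentiable (\<lambda>x. \<Theta> x $ i) z"
  by (simp add: poly_map_def complex_differentiable_poly_eval)

lemma continuous_\<Theta>: "continuous_on S \<Theta>"
  using isCont_if_complex_differentiable_components[OF complex_differentiable_\<Theta>] continuous_at_imp_continuous_on by blast

lemma prod_over_G_invariant: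
  fixes F :: "complex^'n \<Rightarrow> 'b::comm_monoid_mult"
  assumes "C \<in> G"
  shows "(\<Prod>B\<in>G. F (B *v (C *v z))) = (\<Prod>B\<in>G. F (B *v z))"
  by (rule prod.reindex_bij_witness[of _ "\<lambda>B. B ** matrix_inv C" "\<lambda>B. B ** C"])
     (use assms inv_in_G[OF assms] mult_in_G in \<open>auto simp: matrix_vector_mul_assoc matrix_mul_assoc[symmetric]\<close>)

text \<open>
  If \<open>w\<close> is not in the orbit of \<open>z\<close>, choose a functional separating \<open>w\<close> from that orbit.
  The product over \<open>G\<close> of its translates minus its value at \<open>w\<close> is an invariant polynomial
  that vanishes at \<open>w\<close> but not at \<open>z\<close>.
\<close>

lemma \<Theta>_separates_orbits:
  assumes eq: "\<Theta> z = \<Theta> w"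
  shows "\<exists>B\<in>G. w = B *v z"
proof (rule ccontr)
  assume "\<not> ?thesis"
  then have "0 \<notin> (\<lambda>B. B *v z - w) ` G" by auto
  then obtain u where u: "\<And>B. B \<in> G \<Longrightarrow> bilinear_dot u (B *v z - w) \<noteq> 0"
    using exists_functional_nonzero_on[of "(\<lambda>B. B *v z - w) ` G"] finite_G by auto
  define f where "f x = (\<Prod>B\<in>G. bilinear_dot u (B *v x) - bilinear_dot u w)" for x
  have "polynomial_fun f"
    unfolding f_def[abs_def]
    by (intro polynomial_fun_prod polynomial_fun_diff polynomial_fun_bilinear_dot polynomial_fun_const)
  moreover have "f (C *v x) = f x" if "C \<in> G" for C x
    unfolding f_def by (rule prod_over_G_invariant[OF that])
  ultimately obtain P where "\<And>x. f x = poly_eval P (\<Theta> x)"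
    using invariant_polynomial_factors by blast
  then have "f z = f w" using eq by simp
  moreover have "f z \<noteq> 0"
    using u finite_G by (simp add: f_def bilinear_dot_simps)
  moreover have "f w = 0"
    unfolding f_def using one_in_G finite_G by (intro prod_zero bexI[of _ "mat 1"]) simp_all
  ultimately show False by simp
qed

definition regular :: "complex^'n \<Rightarrow> bool" where
  "regular z \<longleftrightarrow> (\<forall>B\<in>G. B *v z = z \<longrightarrow> B = mat 1)"

text \<open>
  An invariant polynomial \<open>f = P \<circ> \<Theta>\<close> has derivative zero in each direction \<open>v\<close> killed by the
  derivative of \<open>\<Theta>\<close>. The product over \<open>G\<close> of the translates of \<open>u - u(a)\<close>, for a
  functional \<open>u\<close>, is such an \<open>f\<close>. At \<open>a\<close> only the factor of the identity vanishes if \<open>u\<close>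
  separates \<open>a\<close> from the rest of its orbit, and then the derivative of \<open>f\<close> in direction \<open>v\<close>
  is a nonzero multiple of \<open>u(v)\<close>.
\<close>

lemma complex_derivative_map_\<Theta>_injective:
  assumes reg: "regular a" and 0: "complex_derivative_map \<Theta> a v = 0"
  shows "v = 0"
proof (rule ccontr)
  assume "v \<noteq> 0"
  then have "0 \<notin> insert v ((\<lambda>B. B *v a - a) ` (G - {mat 1}))"
    using reg by (auto simp: regular_def)
  then obtain u where u: "bilinear_dot u v \<noteq> 0" "\<And>B. B \<in> G - {mat 1} \<Longrightarrow> bilinear_dot u (B *v a - a) \<noteq> 0"
    using exists_functional_nonzero_on[of "insert v ((\<lambda>B. B *v a - a) ` (G - {mat 1}))"] finite_G by auto
  define g where "g x = (\<Prod>B\<in>G - {mat 1}. bilinear_dot u (B *v x) - bilinear_dot u a)" for x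
  define f where "f x = (\<Prod>B\<in>G. bilinear_dot u (B *v x) - bilinear_dot u a)" for x
  have fg: "f x = (bilinear_dot u x - bilinear_dot u a) * g x" for x
    unfolding f_def g_def using finite_G one_in_G by (simp add: prod.remove[of G "mat 1"])
  have poly: "polynomial_fun f" "polynomial_fun g"
    unfolding f_def[abs_def] g_def[abs_def]
    by (intro polynomial_fun_prod polynomial_fun_diff polynomial_fun_bilinear_dot polynomial_fun_const)+
  have "f (C *v x) = f x" if "C \<in> G" for C x
    unfolding f_def by (rule prod_over_G_invariant[OF that])
  then obtain P where "\<And>x. f x = poly_eval P (\<Theta> x)"
    using invariant_polynomial_factors poly(1) by blast
  then have "f = (\<lambda>x. poly_eval P (\<Theta> x))" by blast
  then have "complex_derivative f a v = complex_derivative (poly_eval P) (\<Theta> a) (complex_derivative_map \<Theta> a v)"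
    using complex_differentiable_compose(2)[OF complex_differentiable_poly_eval complex_differentiable_\<Theta>] by simp
  also have "\<dots> = 0"
    using complex_differentiable_has_derivative(2)[OF complex_differentiable_poly_eval, of P "\<Theta> a" 0 0] 0 by simp
  finally have "complex_derivative f a v = 0" .
  moreover have "complex_derivative f a v = bilinear_dot u v * g a"
    unfolding complex_derivative_def
  proof (rule DERIV_imp_deriv)
    have line: "f (a + t *s v) = t * bilinear_dot u v * g (a + t *s v)" for t
      by (simp add: fg bilinear_dot_simps)
    obtain p where "g = poly_eval p" using poly(2) by (auto simp: polynomial_fun_def)
    then have "complex_differentiable g (a + 0 *s v)" by (simp add: complex_differentiable_poly_eval)
    then obtain d where "((\<lambda>t. g (a + t *s v)) has_field_derivative d) (at 0)"
      using complex_differentiable_along_line unfolding field_differentiable_def by blast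
    then show "((\<lambda>t. f (a + t *s v)) has_field_derivative bilinear_dot u v * g a) (at 0)"
      unfolding line by (auto intro!: derivative_eq_intros)
  qed
  moreover have "g a \<noteq> 0"
    using u(2) finite_G by (simp add: g_def bilinear_dot_simps)
  ultimately show False using u(1) by simp
qed

text \<open>
  The coordinate \<open>z $ i\<close> is a root of the monic polynomial whose roots are the \<open>i\<close>-th coordinates
  of the orbit of \<open>z\<close>. Its coefficients are invariant, hence polynomials in \<open>\<Theta> z\<close>, and bounded
  when \<open>\<Theta> z\<close> is.
\<close>

lemma \<Theta>_bounded_preimage:
  assumes "bounded K"
  shows "bounded (\<Theta> -` K)"
proof -
  have "\<exists>M. \<forall>z. \<Theta> z \<in> K \<longrightarrow> cmod (z $ i) \<le> M" for i
  proof -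
    define p where "p z = (\<Prod>B\<in>G. [:- (B *v z) $ i, 1:])" for z
    have deg: "degree (p z) = card G" for z
      unfolding p_def by (simp add: degree_prod_eq_sum_degree)
    have monic: "lead_coeff (p z) = 1" for z
      unfolding p_def lead_coeff_prod by simp
    have "\<exists>C. \<forall>z. coeff (p z) k = poly_eval C (\<Theta> z)" for k
    proof -
      have "polynomial_fun (\<lambda>z. coeff (p z) k)"
        unfolding p_def by (intro polynomial_fun_coeff_prod_linear polynomial_fun_matrix_component)
      moreover have "coeff (p (C *v z)) k = coeff (p z) k" if "C \<in> G" for C z
        unfolding p_def using prod_over_G_invariant[OF that, of "\<lambda>x. [:- x $ i, 1:]"] by simp
      ultimately show ?thesis
        by (rule invariant_polynomial_factors)
    qed
    then obtain C where C: "\<And>k z. coeff (p z) k = poly_eval (C k) (\<Theta> z)" by metis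
    have "\<exists>M. \<forall>y\<in>K. cmod (poly_eval (C k) y) \<le> M" for k
    proof -
      have "bounded (poly_eval (C k) ` closure K)"
        by (intro compact_imp_bounded compact_continuous_image continuous_poly_eval)
           (simp add: compact_closure assms)
      then obtain M where M: "\<forall>x\<in>poly_eval (C k) ` closure K. cmod x \<le> M"
        unfolding bounded_iff ..
      have "cmod (poly_eval (C k) y) \<le> M" if "y \<in> K" for y
        using M that closure_subset[of K] by auto
      then show ?thesis by blast
    qed
    then obtain M where M: "\<And>k y. y \<in> K \<Longrightarrow> cmod (poly_eval (C k) y) \<le> M k" by metis
    have "cmod (z $ i) \<le> 1 + (\<Sum>k<card G. M k)" if "\<Theta> z \<in> K" for z
    proof -
      have "poly (p z) (z $ i) = 0"
        unfolding p_def poly_prod using one_in_G finite_G by (intro prod_zero bexI[of _ "mat 1"]) simp_all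
      then have "cmod (z $ i) \<le> 1 + (\<Sum>k<card G. cmod (coeff (p z) k))"
        using monic_root_bound[OF monic] deg by metis
      also have "\<dots> \<le> 1 + (\<Sum>k<card G. M k)"
        using M[OF that] by (intro add_left_mono sum_mono) (simp add: C)
      finally show ?thesis .
    qed
    then show ?thesis by blast
  qed
  then obtain M where M: "\<And>i z. \<Theta> z \<in> K \<Longrightarrow> cmod (z $ i) \<le> M i" by metis
  have "norm z \<le> (\<Sum>i\<in>UNIV. M i)" if "\<Theta> z \<in> K" for z
  proof -
    have "norm z \<le> (\<Sum>i\<in>UNIV. cmod (z $ i))"
      unfolding norm_vec_def by (rule L2_set_le_sum) simp
    also have "\<dots> \<le> (\<Sum>i\<in>UNIV. M i)" by (intro sum_mono M that)
    finally show ?thesis .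
  qed
  then show ?thesis unfolding bounded_iff by auto
qed

text \<open>
  Preimages of compact sets are compact, so locally in the target the image is that of a compact set.
\<close>

lemma \<Theta>_closed_map:
  assumes "closed S"
  shows "closed (\<Theta> ` S)"
proof -
  have "w \<in> \<Theta> ` S" if w: "w \<in> closure (\<Theta> ` S)" for w
  proof -
    have "closed (\<Theta> -` cball w 1)"
      using continuous_closed_vimage[of "cball w 1" \<Theta>] isCont_if_complex_differentiable_components[OF complex_differentiable_\<Theta>] by simp
    then have "compact (S \<inter> \<Theta> -` cball w 1)"
      using assms \<Theta>_bounded_preimage[OF bounded_cball] by (simp add: compact_eq_bounded_closed bounded_Int closed_Int)
    then have "closed (\<Theta> ` (S \<inter> \<Theta> -` cball w 1))"
      by (intro compact_imp_closed compact_continuous_image continuous_\<Theta>)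
    moreover have "w \<in> closure (\<Theta> ` (S \<inter> \<Theta> -` cball w 1))"
    proof -
      have "w \<in> closure (ball w 1 \<inter> \<Theta> ` S)"
        using w open_Int_closure_subset[of "ball w 1" "\<Theta> ` S"] by auto
      moreover have "ball w 1 \<inter> \<Theta> ` S \<subseteq> \<Theta> ` (S \<inter> \<Theta> -` cball w 1)" by auto
      ultimately show ?thesis using closure_mono by blast
    qed
    ultimately show ?thesis by (auto simp: closure_closed)
  qed
  then show ?thesis by (metis closure_subset closure_subset_eq subsetI)
qed

text \<open>
  For a functional \<open>u\<close>, the product of the differences \<open>u(B C z) - u(C z)\<close> over \<open>C \<in> G\<close> and
  \<open>B \<in> G - {mat 1}\<close> is invariant, and where it is nonzero no \<open>B \<noteq> mat 1\<close> fixes \<open>z\<close>. It is nonzero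
  at some \<open>a\<close>: first choose \<open>a\<close> outside the fixed spaces of the \<open>B\<close>, then \<open>u\<close> nonzero
  on the finitely many differences that occur.
\<close>

lemma discriminant:
  obtains D a where "poly_eval D (\<Theta> a) \<noteq> 0" "\<And>z. poly_eval D (\<Theta> z) \<noteq> 0 \<Longrightarrow> regular z"
proof -
  have "\<exists>i. (B - mat 1) $ i \<noteq> 0" if "B \<noteq> mat 1" for B :: "complex^'n^'n"
  proof (rule ccontr)
    assume "\<not> ?thesis"
    then have "B - mat 1 = 0" by (simp add: vec_eq_iff)
    with that show False by simp
  qed
  then obtain r where r: "\<And>B :: complex^'n^'n. B \<noteq> mat 1 \<Longrightarrow> (B - mat 1) $ r B \<noteq> 0" by metis
  then have "0 \<notin> (\<lambda>B. (B - mat 1) $ r B) ` (G - {mat 1})" by (auto simp del: vector_minus_component) (metis r)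
  then obtain a where a: "\<And>B. B \<in> G - {mat 1} \<Longrightarrow> bilinear_dot a ((B - mat 1) $ r B) \<noteq> 0"
    using exists_functional_nonzero_on[of "(\<lambda>B. (B - mat 1) $ r B) ` (G - {mat 1})"] finite_G by auto
  have reg_a: "B *v a \<noteq> a" if "B \<in> G - {mat 1}" for B
  proof
    assume "B *v a = a"
    then have "(B - mat 1) *v a = 0" by (simp add: matrix_vector_mult_diff_rdistrib)
    then have "((B - mat 1) *v a) $ r B = 0" by simp
    then show False
      using a[OF that] by (simp add: matrix_vector_mult_def bilinear_dot_def mult.commute)
  qed
  have fixed_free: "B *v (C *v a) \<noteq> C *v a" if BC: "B \<in> G - {mat 1}" "C \<in> G" for B C
  proof
    assume fixed: "B *v (C *v a) = C *v a"
    let ?B = "matrix_inv C ** (B ** C)"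
    have "?B *v a = a"
      using fixed inv_in_G(2)[OF BC(2)] by (simp add: matrix_vector_mul_assoc[symmetric])
         (simp add: matrix_vector_mul_assoc)
    moreover have "?B \<in> G" by (intro mult_in_G inv_in_G(1) BC(2)) (use BC in simp)
    ultimately have "?B = mat 1" using reg_a[of ?B] by auto
    then have "C ** ?B ** matrix_inv C = mat 1"
      using inv_in_G(3)[OF BC(2)] by simp
    moreover have "C ** ?B ** matrix_inv C = B"
      using inv_in_G(3)[OF BC(2)] by (simp add: matrix_mul_assoc) (simp add: matrix_mul_assoc[symmetric])
    ultimately show False using BC(1) by simp
  qed
  define V where "V = (\<Union>C\<in>G. (\<lambda>B. B *v (C *v a) - C *v a) ` (G - {mat 1}))"
  have "finite V"
    unfolding V_def using finite_G by simp
  moreover have "0 \<notin> V"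
    unfolding V_def
  proof (rule notI, elim UN_E imageE)
    fix C B assume "C \<in> G" "0 = B *v (C *v a) - C *v a" "B \<in> G - {mat 1}"
    then show False using fixed_free[of B C] by simp
  qed
  ultimately obtain u where "\<forall>v\<in>V. bilinear_dot u v \<noteq> 0"
    using exists_functional_nonzero_on[of V] by blast
  then have u: "bilinear_dot u (B *v (C *v a) - C *v a) \<noteq> 0" if "B \<in> G - {mat 1}" "C \<in> G" for B C
    using that unfolding V_def by blast
  define F where "F x = (\<Prod>B\<in>G - {mat 1}. bilinear_dot u (B *v x) - bilinear_dot u x)" for x
  define f where "f x = (\<Prod>C\<in>G. F (C *v x))" for x
  have "polynomial_fun (\<lambda>x. F (C *v x))" for C
    unfolding F_def matrix_vector_mul_assoc
    by (intro polynomial_fun_prod polynomial_fun_diff polynomial_fun_bilinear_dot polynomial_fun_const)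
  then have "polynomial_fun f"
    unfolding f_def[abs_def] by (intro polynomial_fun_prod)
  moreover have "f (C *v x) = f x" if "C \<in> G" for C x
    unfolding f_def by (rule prod_over_G_invariant[OF that])
  ultimately obtain D where D: "\<And>x. f x = poly_eval D (\<Theta> x)"
    using invariant_polynomial_factors by blast
  show thesis
  proof
    show "poly_eval D (\<Theta> a) \<noteq> 0"
      using u finite_G by (simp add: D[symmetric] f_def F_def bilinear_dot_simps)
    fix z assume "poly_eval D (\<Theta> z) \<noteq> 0"
    then have "F z \<noteq> 0"
      using finite_G one_in_G by (auto simp: D[symmetric] f_def dest: bspec[of _ _ "mat 1"])
    then have nz: "bilinear_dot u (B *v z) - bilinear_dot u z \<noteq> 0" if "B \<in> G - {mat 1}" for B
      using finite_G that by (simp add: F_def)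
    show "regular z"
      unfolding regular_def
    proof (intro ballI impI, rule ccontr)
      fix B assume "B \<in> G" "B *v z = z" "B \<noteq> mat 1"
      then show False using nz[of B] by simp
    qed
  qed
qed

lemma regular_interior_range:
  assumes "regular a"
  shows "\<Theta> a \<in> interior (range \<Theta>)"
proof -
  note D = has_derivative_complex_derivative_map(1)[OF complex_differentiable_\<Theta>, of a]
  have lin: "linear (complex_derivative_map \<Theta> a)" using has_derivative_linear[OF D] .
  then have "inj (complex_derivative_map \<Theta> a)"
    using complex_derivative_map_\<Theta>_injective[OF assms] by (simp add: linear_injective_0)
  then obtain g where g: "linear g" "\<And>x. complex_derivative_map \<Theta> a (g x) = x"
    using linear_injective_isomorphism[OF lin] by blast
  show ?thesis
    by (rule sussmann_open_mapping[OF open_UNIV continuous_\<Theta> UNIV_I D])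
       (use g in \<open>auto simp: linear_conv_bounded_linear\<close>)
qed

text \<open>
  On the line \<open>L\<close> through a point outside the zeros of \<open>D\<close> and an arbitrary point, the parameters
  with \<open>D \<noteq> 0\<close> form a connected dense set, in which those mapped into the range of \<open>\<Theta>\<close> are
  open and closed.
\<close>

lemma \<Theta>_surj: "surj \<Theta>"
proof -
  obtain D a where Da: "poly_eval D (\<Theta> a) \<noteq> 0" and D: "\<And>z. poly_eval D (\<Theta> z) \<noteq> 0 \<Longrightarrow> regular z"
    using discriminant by blast
  have closed: "closed (range \<Theta>)" by (rule \<Theta>_closed_map) simp
  have "w \<in> range \<Theta>" for w
  proof -
    define L where "L t = \<Theta> a + t *s (w - \<Theta> a)" for t
    define Z where "Z = {t. poly_eval D (L t) = 0}"
    have Z: "countable Z"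
      unfolding Z_def L_def by (rule poly_eval_nonzero_on_line[OF Da])
    have conn: "connected (- Z)"
      unfolding Compl_eq_Diff_UNIV
      by (rule connected_open_diff_countable[OF _ open_UNIV connected_UNIV Z]) simp
    have contL: "continuous_on S L" for S
      unfolding L_def[abs_def] by (intro continuous_intros)
    have "openin (top_of_set (- Z)) (- Z \<inter> L -` interior (range \<Theta>))"
      by (rule continuous_openin_preimage_gen[OF contL open_interior])
    moreover have "closedin (top_of_set (- Z)) (- Z \<inter> L -` range \<Theta>)"
      by (rule continuous_closedin_preimage[OF contL closed])
    moreover have "- Z \<inter> L -` range \<Theta> = - Z \<inter> L -` interior (range \<Theta>)"
    proof -
      have "L t \<in> interior (range \<Theta>)" if t: "t \<notin> Z" "L t \<in> range \<Theta>" for t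
      proof -
        obtain z where z: "L t = \<Theta> z" using t(2) by blast
        then have "regular z" using D t(1) by (simp add: Z_def)
        then show ?thesis using regular_interior_range z by simp
      qed
      then show ?thesis using interior_subset by blast
    qed
    moreover have "0 \<in> - Z \<inter> L -` range \<Theta>"
      using Da by (simp add: Z_def L_def)
    ultimately have "- Z \<inter> L -` range \<Theta> = - Z"
      using conn unfolding connected_clopen by (metis empty_iff)
    then have "L ` (- Z) \<subseteq> range \<Theta>" by blast
    then have "L ` closure (- Z) \<subseteq> range \<Theta>"
      by (rule image_closure_subset[OF contL closed])
    then have "L 1 \<in> range \<Theta>" using closure_diff_countable[OF Z] by blast
    then show ?thesis by (simp add: L_def)
  qed
  then show ?thesis by blast
qed

text \<open>
  The \<open>G\<close>-saturation \<open>S\<close> of an open set is open and has the same image; the image of the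
  complement of \<open>S\<close> is closed and is precisely the complement of the image.
\<close>

lemma \<Theta>_open_map:
  assumes "open U"
  shows "open (\<Theta> ` U)"
proof -
  define S where "S = (\<Union>B\<in>G. (\<lambda>z. B *v z) -` U)"
  have opS: "open S"
    unfolding S_def using assms
    by (intro open_UN ballI continuous_open_vimage) (auto intro: linear_continuous_at matrix_vector_mul_bounded_linear)
  have "\<Theta> ` U = \<Theta> ` S"
  proof
    show "\<Theta> ` U \<subseteq> \<Theta> ` S"
      using one_in_G by (force simp: S_def intro!: image_mono)
    show "\<Theta> ` S \<subseteq> \<Theta> ` U"
    proof
      fix y assume "y \<in> \<Theta> ` S"
      then obtain B z where "B \<in> G" "B *v z \<in> U" "y = \<Theta> z" by (auto simp: S_def)
      then show "y \<in> \<Theta> ` U" using \<Theta>_invariant by (intro image_eqI[of _ _ "B *v z"]) auto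
    qed
  qed
  also have "\<dots> = - \<Theta> ` (- S)"
  proof -
    have "z \<in> S" if eq: "\<Theta> z = \<Theta> w" and w: "w \<in> S" for z w
    proof -
      obtain C where C: "C \<in> G" "w = C *v z" using \<Theta>_separates_orbits[OF eq] by blast
      obtain B where "B \<in> G" "B *v w \<in> U" using w by (auto simp: S_def)
      then have "B ** C \<in> G" "(B ** C) *v z \<in> U"
        using C mult_in_G by (auto simp: matrix_vector_mul_assoc)
      then show ?thesis by (auto simp: S_def)
    qed
    then have "\<Theta> ` S \<subseteq> - \<Theta> ` (- S)"
      by (intro subsetI ComplI; elim imageE) (metis ComplD)
    moreover have "- \<Theta> ` (- S) \<subseteq> \<Theta> ` S"
    proof
      fix y assume y: "y \<in> - \<Theta> ` (- S)"
      obtain z where "y = \<Theta> z" using \<Theta>_surj by blast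
      then show "y \<in> \<Theta> ` S" using y by blast
    qed
    ultimately show ?thesis by blast
  qed
  also have "open \<dots>"
    using \<Theta>_closed_map[of "- S"] opS by (simp add: closed_Compl open_Compl)
  finally show ?thesis .
qed

text \<open>
  Each of the finitely many \<open>B \<noteq> mat 1\<close> in \<open>G\<close> moves a small neighbourhood of \<open>a\<close> off
  itself, and the fibres are orbits.
\<close>

lemma \<Theta>_locally_injective:
  assumes reg: "regular a"
  obtains U where "open U" "a \<in> U" "inj_on \<Theta> U"
proof -
  have "\<exists>U. open U \<and> a \<in> U \<and> (\<forall>z\<in>U. B *v z \<notin> U)" if B: "B \<in> G - {mat 1}" for B
  proof -
    have "B *v a \<noteq> a" using B reg unfolding regular_def by blast
    then obtain P Q where PQ: "open P" "open Q" "B *v a \<in> P" "a \<in> Q" "P \<inter> Q = {}"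
      by (meson hausdorff)
    have "open ((*v) B -` P)"
      by (rule continuous_open_vimage[OF PQ(1)])
         (auto intro: linear_continuous_at matrix_vector_mul_bounded_linear)
    then show ?thesis
      using PQ by (intro exI[of _ "Q \<inter> (*v) B -` P"]) auto
  qed
  then obtain U where U: "\<And>B. B \<in> G - {mat 1} \<Longrightarrow> open (U B)" "\<And>B. B \<in> G - {mat 1} \<Longrightarrow> a \<in> U B"
    "\<And>B z. B \<in> G - {mat 1} \<Longrightarrow> z \<in> U B \<Longrightarrow> B *v z \<notin> U B" by metis
  show thesis
  proof
    show "open (\<Inter>B\<in>G - {mat 1}. U B)" using finite_G U(1) by (intro open_INT) auto
    show "a \<in> (\<Inter>B\<in>G - {mat 1}. U B)" using U(2) by blast
    show "inj_on \<Theta> (\<Inter>B\<in>G - {mat 1}. U B)"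
    proof (rule inj_onI)
      fix z w assume z: "z \<in> (\<Inter>B\<in>G - {mat 1}. U B)" and w: "w \<in> (\<Inter>B\<in>G - {mat 1}. U B)"
        and eq: "\<Theta> z = \<Theta> w"
      obtain B where B: "B \<in> G" "w = B *v z" using \<Theta>_separates_orbits[OF eq] by blast
      have "B = mat 1"
      proof (rule ccontr)
        assume "B \<noteq> mat 1"
        then have "B \<in> G - {mat 1}" using B by blast
        then show False using U(3)[of B z] z w B(2) by blast
      qed
      then show "z = w" using B by simp
    qed
  qed
qed

text \<open>
  A holomorphic function constant on the orbits is a holomorphic function of \<open>\<Theta>\<close>. Continuity
  holds since \<open>\<Theta>\<close> is open. Off the zeros of \<open>D\<close> the map \<open>\<Theta>\<close> is locally injective and
  thus has a local holomorphic inverse. The weighted Rado theorem with weight \<open>D\<close> does the rest.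
\<close>

lemma holomorphic_factor:
  fixes f fhat :: "complex^'n \<Rightarrow> complex^'n"
  assumes \<Omega>: "open \<Omega>" and f: "\<And>z i. z \<in> \<Omega> \<Longrightarrow> complex_differentiable (\<lambda>x. f x $ i) z"
    and fhat: "\<And>z. z \<in> \<Omega> \<Longrightarrow> fhat (\<Theta> z) = f z" and w: "w \<in> \<Theta> ` \<Omega>"
  shows "complex_differentiable (\<lambda>x. fhat x $ i) w"
proof -
  have opW: "open (\<Theta> ` \<Omega>)" by (rule \<Theta>_open_map[OF \<Omega>])
  have contf: "continuous_on \<Omega> f"
    by (rule continuous_on_if_complex_differentiable_components[OF f])
  have cont: "continuous_on (\<Theta> ` \<Omega>) fhat"
    unfolding continuous_on_open_vimage[OF opW]
  proof (intro allI impI)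
    fix B :: "(complex^'n) set" assume "open B"
    have "fhat -` B \<inter> \<Theta> ` \<Omega> = \<Theta> ` (\<Omega> \<inter> f -` B)"
      using fhat by (auto intro!: image_eqI)
    also have "open \<dots>"
      by (intro \<Theta>_open_map continuous_open_preimage contf \<Omega> \<open>open B\<close>)
    finally show "open (fhat -` B \<inter> \<Theta> ` \<Omega>)" .
  qed
  obtain D a where Da: "poly_eval D (\<Theta> a) \<noteq> 0" and D: "\<And>z. poly_eval D (\<Theta> z) \<noteq> 0 \<Longrightarrow> regular z"
    using discriminant by blast
  show ?thesis
  proof (rule Rado_with_weight_several_variables[OF opW _ _ _ _ _ w, where j = "poly_eval D"])
    show "continuous_on (\<Theta> ` \<Omega>) (\<lambda>x. fhat x $ i)"
      using cont by (intro continuous_intros)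
    show "continuous_on (\<Theta> ` \<Omega>) (poly_eval D)" by (rule continuous_poly_eval)
    show "complex_differentiable (poly_eval D) z" for z by (rule complex_differentiable_poly_eval)
    have "\<Theta> ` \<Omega> \<inter> closure {w. poly_eval D w \<noteq> 0} \<subseteq> closure (\<Theta> ` \<Omega> \<inter> {w. poly_eval D w \<noteq> 0})"
      by (rule open_Int_closure_subset[OF opW])
    then show "\<Theta> ` \<Omega> \<subseteq> closure {w \<in> \<Theta> ` \<Omega>. poly_eval D w \<noteq> 0}"
      by (simp add: closure_poly_eval_nonzero[OF Da] Int_def)
    fix y assume y: "y \<in> \<Theta> ` \<Omega>" "poly_eval D y \<noteq> 0"
    then obtain z where z: "z \<in> \<Omega>" "y = \<Theta> z" by blast
    then have "regular z" using D y(2) by simp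
    then obtain U where U: "open U" "z \<in> U" "inj_on \<Theta> U"
      by (rule \<Theta>_locally_injective)
    let ?U = "U \<inter> \<Omega>" and ?g = "inv_into (U \<inter> \<Omega>) \<Theta>"
    have opU: "open ?U" using U \<Omega> by blast
    have injU: "inj_on \<Theta> ?U" using U(3) by (rule inj_on_subset) simp
    have g: "?g (\<Theta> x) = x" if "x \<in> ?U" for x
      using injU that by (rule inv_into_f_f)
    have yU: "y \<in> \<Theta> ` ?U" using z U by blast
    have complex_differentiable_g: "complex_differentiable (\<lambda>x. ?g x $ k) y" for k
      by (rule injective_holomorphic_imp_holomorphic_inverse(2)[OF opU complex_differentiable_\<Theta> injU _ yU]) (rule g)
    show "complex_differentiable (\<lambda>x. fhat x $ i) y"
    proof (rule complex_differentiable_transform[OF _ \<Theta>_open_map[OF opU] yU])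
      have "?g y = z" using g z U by blast
      then have "complex_differentiable (\<lambda>x. f x $ i) (?g y)" using f[OF z(1)] by simp
      then show "complex_differentiable (\<lambda>x. f (?g x) $ i) y"
        by (rule complex_differentiable_compose(1)[where f = ?g]) (rule complex_differentiable_g)
      show "f (?g x) $ i = fhat x $ i" if "x \<in> \<Theta> ` ?U" for x
        using that g fhat by auto
    qed
  qed
qed

end

section \<open>The factorization\<close>

theorem proposition2p3:
  fixes G :: "(complex^'n^'n) set"
    and f :: "complex^'n \<Rightarrow> complex^'n"
    and \<Omega>1 \<Omega>2 :: "(complex^'n) set"
    and \<theta> :: "'n \<Rightarrow> 'n cpoly"
  assumes "complex_reflection_group G"
    and "is_domain \<Omega>1" and "is_domain \<Omega>2"
    and "proper_holomorphic_map f \<Omega>1 \<Omega>2"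
    and "deck_group G f \<Omega>1"
    and "basic_polynomials G \<theta>"
  shows "\<exists>!fhat. fhat \<in> extensional (poly_map \<theta> ` \<Omega>1) \<and>
           biholomorphic_map fhat (poly_map \<theta> ` \<Omega>1) \<Omega>2 \<and>
           (\<forall>z\<in>\<Omega>1. f z = fhat (poly_map \<theta> z))"
proof -
  have "finite G" "subgroup G GL" "invariant_polys G = range (\<lambda>p. poly_compose p \<theta>)"
    using assms(1,6) by (simp_all add: complex_reflection_group_def basic_polynomials_def)
  then interpret invariant_generators G \<theta>
    by (rule invariant_generators.intro)
  have op1: "open \<Omega>1" and ne1: "\<Omega>1 \<noteq> {}" and op2: "open \<Omega>2" and conn2: "connected \<Omega>2"
    using assms(2,3) by (auto simp: is_domain_def)
  have f12: "f ` \<Omega>1 \<subseteq> \<Omega>2" and complex_differentiable_f: "\<And>z i. z \<in> \<Omega>1 \<Longrightarrow> complex_differentiable (\<lambda>x. f x $ i) z"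
    and proper: "proper_map (top_of_set \<Omega>1) (top_of_set \<Omega>2) f"
    using assms(4) by (auto simp: proper_holomorphic_map_def holomorphic_map_on_iff_complex_differentiable)
  have orbit: "{w \<in> \<Omega>1. f w = f z} = (\<lambda>B. B *v z) ` G" if "z \<in> \<Omega>1" for z
    using assms(5) that by (simp add: deck_group_def orbit_eq)
  have same_fibres: "f z = f w \<longleftrightarrow> \<Theta> z = \<Theta> w" if z: "z \<in> \<Omega>1" and w: "w \<in> \<Omega>1" for z w
  proof
    assume "f z = f w"
    then have "w \<in> (\<lambda>B. B *v z) ` G" using orbit[OF z] w by auto
    then show "\<Theta> z = \<Theta> w" using \<Theta>_invariant by auto
  next
    assume "\<Theta> z = \<Theta> w"
    then have "w \<in> {w \<in> \<Omega>1. f w = f z}"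
      unfolding orbit[OF z] using \<Theta>_separates_orbits by blast
    then show "f z = f w" by simp
  qed
  define W where "W = \<Theta> ` \<Omega>1"
  \<comment> \<open>The chosen point of the fibre is immaterial by \<open>same_fibres\<close>.\<close>
  define fhat where "fhat = restrict (\<lambda>w. f (inv_into \<Omega>1 \<Theta> w)) W"
  have fhat: "fhat (\<Theta> z) = f z" if "z \<in> \<Omega>1" for z
  proof -
    have W: "\<Theta> z \<in> \<Theta> ` \<Omega>1" using that by blast
    have "f (inv_into \<Omega>1 \<Theta> (\<Theta> z)) = f z"
      using same_fibres[OF inv_into_into[OF W] that] f_inv_into_f[OF W] by simp
    then show ?thesis using W by (simp add: fhat_def W_def)
  qed
  have opW: "open W" unfolding W_def by (rule \<Theta>_open_map[OF op1])
  have complex_differentiable_fhat: "complex_differentiable (\<lambda>x. fhat x $ i) w" if "w \<in> W" for w i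
    using holomorphic_factor[OF op1 complex_differentiable_f fhat] that by (simp add: W_def)
  have inj: "inj_on fhat W"
    unfolding W_def by (rule inj_onI) (auto simp: fhat same_fibres)
  have inv: "the_inv_into W fhat (fhat w) = w" if "w \<in> W" for w
    by (rule the_inv_into_f_f[OF inj that])
  note inverse = injective_holomorphic_imp_holomorphic_inverse[OF opW complex_differentiable_fhat inj inv]
  have image: "fhat ` W = f ` \<Omega>1"
    unfolding W_def image_image using fhat by simp
  have "f ` \<Omega>1 = \<Omega>2"
  proof -
    \<comment> \<open>The image is open and closed in the connected set \<open>\<Omega>2\<close>.\<close>
    have "closed_map (top_of_set \<Omega>1) (top_of_set \<Omega>2) f"
      using proper by (simp add: proper_map_def)
    then have "closedin (top_of_set \<Omega>2) (f ` \<Omega>1)"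
      unfolding closed_map_def by (metis closedin_topspace topspace_euclidean_subtopology)
    moreover have "openin (top_of_set \<Omega>2) (f ` \<Omega>1)"
      using inverse(1) f12 by (simp add: image openin_open_eq[OF op2])
    ultimately show ?thesis
      using conn2 ne1 unfolding connected_clopen by (metis image_is_empty)
  qed
  then have image2: "fhat ` W = \<Omega>2" using image by simp
  have bihol: "biholomorphic_map fhat W \<Omega>2"
    unfolding biholomorphic_map_def holomorphic_map_on_iff_complex_differentiable
    using opW op2 inj image2 complex_differentiable_fhat inverse(2) by (auto simp: bij_betw_def)
  show ?thesis
    unfolding W_def[symmetric]
  proof (rule ex1I[of _ fhat])
    show "fhat \<in> extensional W \<and> biholomorphic_map fhat W \<Omega>2 \<and> (\<forall>z\<in>\<Omega>1. f z = fhat (\<Theta> z))"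
      using bihol fhat by (simp add: fhat_def)
    fix k assume k: "k \<in> extensional W \<and> biholomorphic_map k W \<Omega>2 \<and> (\<forall>z\<in>\<Omega>1. f z = k (\<Theta> z))"
    show "k = fhat"
    proof (rule extensionalityI)
      show "k \<in> extensional W" "fhat \<in> extensional W" using k by (simp_all add: fhat_def)
      fix w assume "w \<in> W"
      then obtain z where "z \<in> \<Omega>1" "w = \<Theta> z" by (auto simp: W_def)
      then show "k w = fhat w" using k fhat by simp
    qed
  qed
qed

end
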